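(* Define, for $1/2<\beta<1$, $$\rho^*(\beta)=\begin{cases}\beta-1/2, & 1/2<\beta\le 3/4,\\ (1-\sqrt{1-\beta})^2, & 3/4<\beta<1.\end{cases}$$ For each $s\in[-1,2]$, the detection boundary $\rho_s$ of the tests of $H_0$ versus $H_1^{(n)}$ based on $S_n^+(s)$ satisfies $\rho_s(\beta)=\rho^*(\beta)$ for $1/2<\beta<1$. Here $\rho_s(\beta)$ is defined by the following property: if $\mu_n=\sqrt{2r\log n}$ and a sequence of levels $\alpha_n\to0$ is used which tends to $0$ slowly enough that $n\,q_n(s,\alpha_n)=(1+o(1))\log\log n$, then for $r>\rho_s(\beta)$ the resulting sequence of tests based on $S_n^+(s)$ has power against $H_1^{(n)}$ tending to $1$ as $n\to\infty$, while for $r<\rho_s(\beta)$ the sequence of tests has power tending to $0$.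
   Context: Testing problem: for each $n$ one observes $X_1,\ldots,X_n$ i.i.d. on $[0,1]$. Under $H_0$ their common distribution is Uniform$(0,1)$. Under $H_1^{(n)}$ (depending on $\beta\in(1/2,1)$ and $r\in(0,1)$) their common distribution function is $$F_n(u)=u+\epsilon_n\{(1-u)-\Phi(\Phi^{-1}(1-u)-\mu_n)\},\qquad \epsilon_n=n^{-\beta},\ \mu_n=\sqrt{2r\log n},$$ where $\Phi$ is the standard normal distribution function. (Equivalently $X_i=1-\Phi(Y_i)$ with $Y_i$ i.i.d. $N(0,1)$ under $H_0$ and $Y_i$ i.i.d. with distribution function $(1-\epsilon_n)\Phi+\epsilon_n\Phi(\cdot-\mu_n)$ under $H_1^{(n)}$.) $\mathbb{F}_n$ is the empirical distribution function, $X_{(1)}$ the minimum and $X_{(n)}$ the maximum of $X_1,\ldots,X_n$. For $s\in\mathbb{R}\setminus\{0,1\}$, $$K_s(u,v)=\frac{1}{s(1-s)}\{1-u^sv^{1-s}-(1-u)^s(1-v)^{1-s}\},$$ $K_1(u,v)=u\log(u/v)+(1-u)\log\frac{1-u}{1-v}$ (with $0\log 0=0$), $K_0(u,v)=K_1(v,u)$; and $K_s^+(u,v)=K_s(u,v)$ if $0<v<u<1$, $K_s^+(u,v)=0$ otherwise. The one-sided statistic on which the tests are based (large values being significant) is $$S_n^+(s)=\sup_{X_{(1)}\le x\le 1/2}K_s^+(\mathbb{F}_n(x),x).$$ The two-sided statistic is $S_n(s)=\sup_{0<x<1}K_s(\mathbb{F}_n(x),x)$ if $s\ge1$ and $S_n(s)=\sup_{X_{(1)}\le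 x<X_{(n)}}K_s(\mathbb{F}_n(x),x)$ if $s<1$. The number $q_n(s,\alpha)$ denotes the $(1-\alpha)$-quantile of the distribution of the two-sided statistic $S_n(s)$ under $H_0$, i.e. $P_{H_0}(S_n(s)\le q_n(s,\alpha))=1-\alpha$. *)

theory Defs
  imports "HOL-Probability.Probability" "HOL-Library.Landau_Symbols"
begin

text \<open>A sample of size \<open>n\<close> is a function \<open>X :: nat \<Rightarrow> real\<close>, of which only the values
  \<open>X i\<close> with \<open>i < n\<close> matter.\<close>

definition ecdf :: "nat \<Rightarrow> (nat \<Rightarrow> real) \<Rightarrow> real \<Rightarrow> real" where
  "ecdf n X x = real (card {i. i < n \<and> X i \<le> x}) / real n"

definition sample_min :: "nat \<Rightarrow> (nat \<Rightarrow> real) \<Rightarrow> real" where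
  "sample_min n X = Min (X ` {..<n})"

definition sample_max :: "nat \<Rightarrow> (nat \<Rightarrow> real) \<Rightarrow> real" where
  "sample_max n X = Max (X ` {..<n})"

text \<open>The convention \<open>0 log 0 = 0\<close> holds because \<open>0 * y = 0\<close> and \<open>ln\<close> is total.\<close>

definition K1 :: "real \<Rightarrow> real \<Rightarrow> real" where
  "K1 u v = u * ln (u / v) + (1 - u) * ln ((1 - u) / (1 - v))"

text \<open>\<open>0 powr a = 0\<close> for every \<open>a\<close>, so for \<open>s < 0\<close> the formula is not the usual one
  (value \<open>\<infinity>\<close>) at \<open>u \<in> {0, 1}\<close>; likewise for \<open>s = 0\<close>. The statistics below evaluate \<open>K s\<close> with
  \<open>s < 1\<close> only at \<open>0 < u < 1\<close>, and with \<open>0 < v < 1\<close> for samples in the open unit interval, that is,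
  almost surely.\<close>

definition K :: "real \<Rightarrow> real \<Rightarrow> real \<Rightarrow> real" where
  "K s u v =
    (if s = 1 then K1 u v
     else if s = 0 then K1 v u
     else 1 / (s * (1 - s)) *
       (1 - u powr s * v powr (1 - s) - (1 - u) powr s * (1 - v) powr (1 - s)))"

definition K_plus :: "real \<Rightarrow> real \<Rightarrow> real \<Rightarrow> real" where
  "K_plus s u v = (if 0 < v \<and> v < u \<and> u < 1 then K s u v else 0)"

text \<open>The suprema are taken in the extended reals, so that no boundedness has to be presupposed;
  the supremum over an empty range is \<open>-\<infinity>\<close>.\<close>

definition S_two :: "real \<Rightarrow> nat \<Rightarrow> (nat \<Rightarrow> real) \<Rightarrow> ereal" where
  "S_two s n X =
    (if s \<ge> 1 then (SUP x\<in>{0<..<1}. ereal (K s (ecdf n X x) x))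
     else (SUP x\<in>{sample_min n X..<sample_max n X}. ereal (K s (ecdf n X x) x)))"

definition S_plus :: "real \<Rightarrow> nat \<Rightarrow> (nat \<Rightarrow> real) \<Rightarrow> ereal" where
  "S_plus s n X = (SUP x\<in>{sample_min n X..1/2}. ereal (K_plus s (ecdf n X x) x))"

definition H0_law :: "nat \<Rightarrow> (nat \<Rightarrow> real) measure" where
  "H0_law n = (\<Pi>\<^sub>M i\<in>{..<n}. uniform_measure lborel {0..1})"

definition std_normal_cdf :: "real \<Rightarrow> real" where
  "std_normal_cdf = cdf std_normal_distribution"

definition eps :: "real \<Rightarrow> nat \<Rightarrow> real" where
  "eps \<beta> n = real n powr (-\<beta>)"

definition mu :: "real \<Rightarrow> nat \<Rightarrow> real" where
  "mu r n = sqrt (2 * r * ln (real n))"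

text \<open>\<open>inv std_normal_cdf\<close> is the true inverse on the open unit interval, the only
  place where it is used. The distribution function is extended by 0 and 1 outside.\<close>

definition H1_cdf :: "real \<Rightarrow> real \<Rightarrow> nat \<Rightarrow> real \<Rightarrow> real" where
  "H1_cdf \<beta> r n u =
    (if u \<le> 0 then 0 else if u \<ge> 1 then 1
     else u + eps \<beta> n *
       ((1 - u) - std_normal_cdf (inv std_normal_cdf (1 - u) - mu r n)))"

text \<open>\<open>interval_measure F\<close> is the law on the real line with distribution function \<open>F\<close>.\<close>

definition H1_law :: "real \<Rightarrow> real \<Rightarrow> nat \<Rightarrow> (nat \<Rightarrow> real) measure" where
  "H1_law \<beta> r n = (\<Pi>\<^sub>M i\<in>{..<n}. interval_measure (H1_cdf \<beta> r n))"

text \<open>\<open>q\<close> is a \<open>(1 - a)\<close>-quantile of the two-sided statistic under the null hypothesis.\<close>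

definition is_quantile :: "real \<Rightarrow> nat \<Rightarrow> real \<Rightarrow> real \<Rightarrow> bool" where
  "is_quantile s n a q \<longleftrightarrow>
    measure (H0_law n) {X \<in> space (H0_law n). S_two s n X \<le> ereal q} = 1 - a"

text \<open>The quantile equation is required only for large \<open>n\<close>: it has no solution for \<open>n = 1\<close> and
  \<open>s < 1\<close>, where the range of the supremum is empty.\<close>

definition admissible_levels :: "real \<Rightarrow> (nat \<Rightarrow> real) \<Rightarrow> (nat \<Rightarrow> real) \<Rightarrow> bool" where
  "admissible_levels s \<alpha> q \<longleftrightarrow>
    (\<forall>n. 0 < \<alpha> n \<and> \<alpha> n < 1) \<and> \<alpha> \<longlonglongrightarrow> 0 \<and>
    (\<forall>\<^sub>F n in sequentially. is_quantile s n (\<alpha> n) (q n)) \<and>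
    (\<lambda>n. real n * q n) \<sim>[sequentially] (\<lambda>n. ln (ln (real n)))"

text \<open>Power of the test that rejects when the one-sided statistic exceeds \<open>c\<close>.\<close>

definition power_plus :: "real \<Rightarrow> real \<Rightarrow> real \<Rightarrow> nat \<Rightarrow> real \<Rightarrow> real" where
  "power_plus s \<beta> r n c =
    measure (H1_law \<beta> r n) {X \<in> space (H1_law \<beta> r n). S_plus s n X > ereal c}"

definition is_detection_boundary :: "real \<Rightarrow> (nat \<Rightarrow> real) \<Rightarrow> real \<Rightarrow> real \<Rightarrow> bool" where
  "is_detection_boundary s q \<beta> \<rho> \<longleftrightarrow>
    (\<forall>r. 0 < r \<and> r < 1 \<longrightarrow>
      (r > \<rho> \<longrightarrow> (\<lambda>n. power_plus s \<beta> r n (q n)) \<longlonglongrightarrow> 1) \<and>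
      (r < \<rho> \<longrightarrow> (\<lambda>n. power_plus s \<beta> r n (q n)) \<longlonglongrightarrow> 0))"

definition rho_star :: "real \<Rightarrow> real" where
  "rho_star \<beta> = (if \<beta> \<le> 3/4 then \<beta> - 1/2 else (1 - sqrt (1 - \<beta>))\<^sup>2)"

end

theory Submission
  imports Defs "HOL-Real_Asymp.Real_Asymp"
begin

text \<open>On the normal scale \<open>Y = \<Phi>\<^sup>-\<^sup>1 (1 - X)\<close> the alternative has density \<open>1 + \<epsilon> (g - 1)\<close>,
  \<open>g y = exp (\<mu> y - \<mu>\<^sup>2 / 2)\<close>, with respect to the standard normal law.

  Below the boundary no test of asymptotic size zero has power: the squared Hellinger distance of a
  single observation is at most \<open>\<epsilon>\<^sup>p (E g\<^sup>p + 1)\<close> for each \<open>1 \<le> p \<le> 2\<close>, and for a suitable \<open>p\<close> this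
  is \<open>o(1 / n)\<close>. The one-sided test has size at most \<open>\<alpha>\<^sub>n\<close> because \<open>S_n\<^sup>+\<close> exceeds a nonnegative
  threshold only if \<open>S_n\<close> does.

  Above the boundary a single point \<open>x\<close> suffices: \<open>K_s (u, v) \<ge> (u - v)\<^sup>2 / (2 u)\<close> for \<open>v < u\<close> and
  \<open>s \<ge> -1\<close>, and the binomial lower tail bound shows that \<open>n K_s (F\<^sub>n(x), x)\<close> is at least a positive
  power of \<open>n\<close>, hence beats \<open>ln (ln n)\<close>.\<close>

section \<open>The divergences and the one-sided statistic\<close>

text \<open>On the normal scale the likelihood ratio is explicit, so all its moments are powers of
  \<open>n\<close>. Its second moment is \<open>n powr (2 * r)\<close>, carried by values of
  \<open>y\<close> near \<open>2 * mu\<close>; once these are too large to occur in a sample of size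
  \<open>n\<close>, the second moment overstates the distance between the hypotheses. A moment order
  \<open>p < 2\<close> tempers such values, and this is how the curved part of the boundary is
  reached.

  At the level \<open>a * sqrt (2 * ln n)\<close> the null mass is \<open>v\<close>, about
  \<open>n powr (- a^2)\<close>, and the excess mass is \<open>d\<close>, about
  \<open>n powr (- \<beta> - c^2)\<close>. The decisive quantity \<open>n * d^2 / (v + d)\<close> is
  large once both \<open>n * d^2 / v\<close> and \<open>n * d\<close> are, which gives two
  conditions on exponents. Only exponents matter: constants and factors
  \<open>exp (O (sqrt (ln n)))\<close> are absorbed into a small power of \<open>n\<close>.\<close>

definition phi_div :: "real \<Rightarrow> real \<Rightarrow> real" where
  "phi_div s x = (if s = 1 then x * ln x - x + 1 else if s = 0 then x - 1 - ln x
     else (1 - s + s * x - x powr s) / (s * (1 - s)))"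

text \<open>The derivative of \<open>phi_div s\<close>. The normalisation gives value and slope 0 at
  1 and second derivative \<open>x powr (s - 2)\<close> for every \<open>s\<close>, including the
  two logarithmic cases.\<close>

definition phi_div' :: "real \<Rightarrow> real \<Rightarrow> real" where
  "phi_div' s x = (if s = 1 then ln x else (1 - x powr (s - 1)) / (1 - s))"

lemma phi_div_has_derivative:
  assumes "0 < x"
  shows "(phi_div s has_real_derivative phi_div' s x) (at x)"
proof -
  consider "s = 1" | "s = 0" | "s \<noteq> 0" "s \<noteq> 1" by blast
  then show ?thesis
  proof cases
    case 1
    have "((\<lambda>x. x * ln x - x + 1) has_real_derivative ln x) (at x)"
      by (rule derivative_eq_intros refl | use assms in simp)+
    with 1 show ?thesis by (simp add: phi_div_def[abs_def] phi_div'_def)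
  next
    case 2
    have "((\<lambda>x. x - 1 - ln x) has_real_derivative 1 - x powr (-1)) (at x)"
      by (rule derivative_eq_intros refl | use assms in \<open>simp add: powr_minus_divide\<close>)+
    with 2 show ?thesis by (simp add: phi_div_def[abs_def] phi_div'_def)
  next
    case 3
    have "((\<lambda>x. (1 - s + s * x - x powr s) / (s * (1 - s))) has_real_derivative
        (s - s * x powr (s - 1)) / (s * (1 - s))) (at x)"
      by (rule derivative_eq_intros refl | use assms 3 in simp)+
    also have "(s - s * x powr (s - 1)) / (s * (1 - s)) = (1 - x powr (s - 1)) / (1 - s)"
      using 3 by (simp add: field_simps)
    finally show ?thesis
      using 3 by (simp add: phi_div_def[abs_def] phi_div'_def)
  qed
qed

lemma phi_div_1 [simp]: "phi_div s 1 = 0"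
  by (simp add: phi_div_def)

text \<open>\<open>K s\<close> is an f-divergence of two Bernoulli laws. The affine terms that
  normalise \<open>phi_div\<close> cancel, because the ratios \<open>u / v\<close> and
  \<open>(1 - u) / (1 - v)\<close> have mean 1 under the weights \<open>v\<close> and
  \<open>1 - v\<close>.\<close>

lemma K_eq_phi_div:
  assumes "0 < u" "u < 1" "0 < v" "v < 1"
  shows "K s u v = v * phi_div s (u / v) + (1 - v) * phi_div s ((1 - u) / (1 - v))"
proof -
  consider "s = 1" | "s = 0" | "s \<noteq> 0" "s \<noteq> 1" by blast
  then show ?thesis
  proof cases
    case 1
    have "b * phi_div 1 (a / b) = a * ln (a / b) - a + b" if "0 < b" for a b :: real
      using that by (simp add: phi_div_def right_diff_distrib distrib_left)
    from this[of v u] this[of "1 - v" "1 - u"] show ?thesis using assms 1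
      by (simp add: K_def K1_def)
  next
    case 2
    have "b * phi_div 0 (a / b) = a - b + b * ln (b / a)" if "0 < a" "0 < b" for a b :: real
      using that by (simp add: phi_div_def ln_div right_diff_distrib)
    from this[of u v] this[of "1 - u" "1 - v"] show ?thesis using assms 2
      by (simp add: K_def K1_def)
  next
    case 3
    have *: "b * phi_div s (a / b) = (b * (1 - s) + s * a - a powr s * b powr (1 - s)) / (s * (1 - s))"
      if "0 < a" "0 < b" for a b :: real
    proof -
      have "b * (a / b) powr s = a powr s * b powr (1 - s)"
        using that by (simp add: powr_divide powr_diff)
      then show ?thesis
        using 3 that by (simp add: phi_div_def right_diff_distrib distrib_left)
    qed
    have "(v * (1 - s) + s * u - u powr s * v powr (1 - s)) +
        ((1 - v) * (1 - s) + s * (1 - u) - (1 - u) powr s * (1 - v) powr (1 - s)) =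
        1 - u powr s * v powr (1 - s) - (1 - u) powr s * (1 - v) powr (1 - s)"
      by (simp add: algebra_simps)
    then show ?thesis
      using 3 *[of u v] *[of "1 - u" "1 - v"] assms
      by (simp add: K_def add_divide_distrib[symmetric])
  qed
qed

lemma phi_div_nonneg:
  assumes "0 < x" "x \<le> 1"
  shows "0 \<le> phi_div s x"
proof -
  have "phi_div s 1 \<le> phi_div s x"
  proof (rule DERIV_nonpos_imp_nonincreasing[OF assms(2)])
    fix y assume y: "x \<le> y" "y \<le> 1"
    have "phi_div' s y \<le> 0"
    proof (cases "s \<le> 1")
      case True
      have "y powr 0 \<le> y powr (s - 1)" if "s < 1"
        using that y assms by (intro powr_mono') auto
      then show ?thesis
        using y assms True by (auto simp: phi_div'_def divide_nonpos_pos)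
    next
      case False
      have "y powr (s - 1) \<le> y powr 0"
        using False y assms by (intro powr_mono') auto
      then show ?thesis
        using y assms False by (auto simp: phi_div'_def divide_nonneg_neg)
    qed
    then show "\<exists>d. (phi_div s has_real_derivative d) (at y) \<and> d \<le> 0"
      using phi_div_has_derivative[of y s] y assms by auto
  qed
  then show ?thesis by simp
qed

text \<open>The left side is the derivative for \<open>s = -1\<close>. For \<open>x\<close> at least
  1 the second derivative \<open>x powr (s - 2)\<close> grows with \<open>s\<close>, so the smallest
  admissible \<open>s\<close> gives the lower bound.\<close>

lemma phi_div'_ge:
  assumes "-1 \<le> s" "1 \<le> x"
  shows "(1 - 1 / x\<^sup>2) / 2 \<le> phi_div' s x"
proof -
  define L where "L = ln x"
  have L: "0 \<le> L" and x: "x = exp L"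
    using assms by (auto simp: L_def)
  have e2: "1 / x\<^sup>2 = exp (- 2 * L)"
    by (simp add: x exp_minus exp_double inverse_eq_divide)
  have e2L: "(1 - exp (- 2 * L)) / 2 \<le> L"
    using exp_ge_add_one_self[of "-2 * L"] by simp
  have es: "x powr (s - 1) = exp ((s - 1) * L)"
    using assms by (simp add: powr_def L_def)
  consider "s = 1" | "s > 1" | "s < 1" by linarith
  then have "(1 - exp (- 2 * L)) / 2 \<le> phi_div' s x"
  proof cases
    case 1
    then show ?thesis using e2L by (simp add: phi_div'_def L_def)
  next
    case 2
    have "1 + (s - 1) * L \<le> exp ((s - 1) * L)"
      by (rule exp_ge_add_one_self)
    then have "L \<le> (exp ((s - 1) * L) - 1) / (s - 1)"
      using 2 by (simp add: field_simps)
    also have "\<dots> = phi_div' s x"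
      using 2 by (simp add: phi_div'_def es divide_simps) (simp add: algebra_simps)
    finally show ?thesis using e2L by simp
  next
    case 3
    \<comment> \<open>The exponent \<open>(s - 1) * L\<close> is the convex combination of
      \<open>0\<close> and \<open>- 2 * L\<close> with weight \<theta>; the bound \<theta> \<le> 1
      is exactly \<open>-1 \<le> s\<close>.\<close>
    define \<theta> where "\<theta> = (1 - s) / 2"
    have th: "0 \<le> \<theta>" "\<theta> \<le> 1" using 3 assms by (auto simp: \<theta>_def)
    have "exp ((1 - \<theta>) *\<^sub>R 0 + \<theta> *\<^sub>R (- 2 * L)) \<le> (1 - \<theta>) * exp 0 + \<theta> * exp (- 2 * L)"
      by (intro convex_onD[OF exp_convex]) (use th in auto)
    moreover have "(1 - \<theta>) *\<^sub>R 0 + \<theta> *\<^sub>R (- 2 * L) = (s - 1) * L"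
      by (simp add: \<theta>_def field_simps)
    ultimately have "exp ((s - 1) * L) \<le> (1 - \<theta>) * exp 0 + \<theta> * exp (- 2 * L)"
      by simp
    then have "\<theta> * (1 - exp (- 2 * L)) \<le> 1 - exp ((s - 1) * L)"
      by (simp add: right_diff_distrib)
    then have "(1 - exp (- 2 * L)) / 2 \<le> (1 - exp ((s - 1) * L)) / (1 - s)"
      using 3 by (simp add: \<theta>_def field_simps)
    then show ?thesis
      using 3 by (simp add: phi_div'_def es)
  qed
  then show ?thesis by (simp add: e2)
qed

text \<open>The left side is \<open>phi_div (-1)\<close>, and both sides vanish at 1, so the
  comparison of derivatives integrates.\<close>

lemma phi_div_ge:
  assumes "-1 \<le> s" "1 \<le> x"
  shows "(x - 1)\<^sup>2 / (2 * x) \<le> phi_div s x"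
proof -
  define D where "D = (\<lambda>x. phi_div s x - (x + 1 / x - 2) / 2)"
  have "D 1 \<le> D x"
  proof (rule DERIV_nonneg_imp_nondecreasing[OF assms(2)])
    fix y assume y: "1 \<le> y" "y \<le> x"
    have "(D has_real_derivative phi_div' s y - (1 - 1 / y\<^sup>2) / 2) (at y)"
      unfolding D_def
      by (rule derivative_eq_intros phi_div_has_derivative refl
          | use y in \<open>simp add: power2_eq_square\<close>)+
    then show "\<exists>d. (D has_real_derivative d) (at y) \<and> 0 \<le> d"
      using phi_div'_ge[OF assms(1) y(1)] by (intro exI conjI) auto
  qed
  moreover have "(x + 1 / x - 2) / 2 = (x - 1)\<^sup>2 / (2 * x)"
    using assms by (simp add: field_simps power2_eq_square)
  ultimately show ?thesis
    by (simp add: D_def)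
qed

text \<open>The cell with ratio \<open>u / v > 1\<close> alone gives the bound; the other cell, with
  ratio below 1, contributes a nonnegative amount.\<close>

lemma K_ge:
  assumes "-1 \<le> s" "0 < v" "v < u" "u < 1"
  shows "(u - v)\<^sup>2 / (2 * u) \<le> K s u v"
proof -
  have "(u - v)\<^sup>2 / (2 * u) = v * ((u / v - 1)\<^sup>2 / (2 * (u / v)))"
    using assms by (simp add: field_simps power2_eq_square)
  also have "\<dots> \<le> v * phi_div s (u / v)"
    using assms by (intro mult_left_mono phi_div_ge) auto
  also have "\<dots> \<le> v * phi_div s (u / v) + (1 - v) * phi_div s ((1 - u) / (1 - v))"
    using assms by (auto intro!: mult_nonneg_nonneg phi_div_nonneg)
  also have "\<dots> = K s u v"
    using assms by (subst K_eq_phi_div) auto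
  finally show ?thesis .
qed

section \<open>Exceedance events of the statistics\<close>

lemma eventually_ecdf_eq_at_right: "\<forall>\<^sub>F y in at_right x. ecdf n X y = ecdf n X x"
proof -
  have "\<forall>\<^sub>F y in at_right x. \<forall>i\<in>{i\<in>{..<n}. x < X i}. y < X i"
    by (rule eventually_ball_finite) (auto intro: eventually_at_right_real[THEN eventually_mono])
  then show ?thesis
    using eventually_at_right_less[of x]
  proof eventually_elim
    case (elim y)
    have "{i. i < n \<and> X i \<le> y} = {i. i < n \<and> X i \<le> x}"
      using elim by force
    then show ?case by (simp add: ecdf_def)
  qed
qed

lemma isCont_K:
  assumes "0 < u" "u < 1" "0 < v" "v < 1"
  shows "isCont (K s u) v"
proof (cases "s = 0 \<or> s = 1")
  case True
  then show ?thesis using assms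
    by (auto simp: K_def[abs_def] K1_def intro!: continuous_intros)
next
  case False
  then show ?thesis using assms
    by (auto simp: K_def[abs_def] intro!: continuous_intros)
qed

lemma sample_min_le:
  assumes "0 < ecdf n X x"
  shows "sample_min n X \<le> x"
proof -
  have "{i. i < n \<and> X i \<le> x} \<noteq> {}"
    using assms by (intro notI) (simp add: ecdf_def)
  then obtain i where "i < n" "X i \<le> x" by blast
  then show ?thesis
    unfolding sample_min_def by (intro Min_le_iff[THEN iffD2]) auto
qed

text \<open>Between sample points the empirical distribution function is constant, so the supremum
  is already exceeded at a rational point.\<close>

lemma S_plus_greater_iff:
  assumes "0 \<le> c"
  shows "ereal c < S_plus s n X \<longleftrightarrow>
    (\<exists>x\<in>\<rat> \<inter> {..1/2}. c < K_plus s (ecdf n X x) x)"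
proof
  assume "ereal c < S_plus s n X"
  then obtain x where x: "x \<le> 1/2" "c < K_plus s (ecdf n X x) x"
    by (auto simp: S_plus_def less_SUP_iff)
  define u where "u = ecdf n X x"
  have xu: "0 < x" "x < u" "u < 1" "c < K s u x"
    using x assms by (auto simp: K_plus_def u_def split: if_splits)
  show "\<exists>x\<in>\<rat> \<inter> {..1/2}. c < K_plus s (ecdf n X x) x"
  proof (cases "x = 1/2")
    \<comment> \<open>The right end of the range leaves no room to move right, but it is rational
      itself.\<close>
    case True
    have "x \<in> \<rat>" unfolding True by (intro Rats_divide) auto
    with x show ?thesis by blast
  next
    case False
    have "(K s u \<longlongrightarrow> K s u x) (at_right x)"
      using isCont_K[of u x s] xu by (auto simp: isCont_def filterlim_at_split)
    then have "\<forall>\<^sub>F y in at_right x. c < K s u y"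
      using xu by (intro order_tendstoD)
    moreover have "\<forall>\<^sub>F y in at_right x. y < min u (1/2)"
      using xu False x by (intro eventually_at_rightI[of x "min u (1/2)"]) auto
    ultimately have "\<forall>\<^sub>F y in at_right x. c < K_plus s (ecdf n X y) y \<and> y \<le> 1/2"
      using eventually_ecdf_eq_at_right[of n X x] eventually_at_right_less[of x]
      by eventually_elim (use xu in \<open>auto simp: K_plus_def u_def\<close>)
    then obtain b where b: "x < b" "\<And>y. x < y \<Longrightarrow> y < b \<Longrightarrow> c < K_plus s (ecdf n X y) y \<and> y \<le> 1/2"
      unfolding eventually_at_right_field by blast
    obtain y where "y \<in> \<rat>" "x < y" "y < b"
      using Rats_dense_in_real[OF b(1)] by blast
    then show ?thesis using b(2)[of y] by blast
  qed
next
  assume "\<exists>x\<in>\<rat> \<inter> {..1/2}. c < K_plus s (ecdf n X x) x"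
  then obtain x where x: "x \<le> 1/2" "c < K_plus s (ecdf n X x) x" by auto
  \<comment> \<open>Since \<open>c\<close> is nonnegative, exceeding it excludes the default value 0
    of \<open>K_plus\<close>. So the empirical distribution function is positive at
    \<open>x\<close>, and the lower limit \<open>sample_min\<close> of the range holds
    automatically.\<close>
  then have "0 < ecdf n X x"
    using assms by (auto simp: K_plus_def split: if_splits)
  from sample_min_le[OF this] x show "ereal c < S_plus s n X"
    by (auto simp: S_plus_def less_SUP_iff intro!: bexI[of _ x])
qed

lemma S_plus_greaterI:
  assumes "x \<le> 1/2" "0 < x" "x < ecdf n X x" "ecdf n X x < 1" "c < K s (ecdf n X x) x"
  shows "ereal c < S_plus s n X"
  using sample_min_le[of n X x] assms
  by (auto simp: S_plus_def less_SUP_iff K_plus_def intro!: bexI[of _ x])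

text \<open>A nonnegative threshold can be exceeded only where \<open>K_plus\<close> is
  \<open>K\<close> itself, at a point with \<open>0 < x < u < 1\<close>. Here \<open>u < 1\<close>
  means that some observation is larger than \<open>x\<close>, so \<open>x\<close> lies in the range
  of the two-sided statistic for either definition of it.\<close>

lemma S_two_greater:
  assumes "0 \<le> c" "ereal c < S_plus s n X"
  shows "ereal c < S_two s n X"
proof -
  obtain x where x: "sample_min n X \<le> x" "x \<le> 1/2" "c < K_plus s (ecdf n X x) x"
    using assms by (auto simp: S_plus_def less_SUP_iff)
  define u where "u = ecdf n X x"
  have xu: "0 < x" "x < u" "u < 1" "c < K s u x"
    using x assms by (auto simp: K_plus_def u_def split: if_splits)
  have "x < sample_max n X"
  proof (rule ccontr)
    assume "\<not> x < sample_max n X"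
    moreover have "X i \<le> sample_max n X" if "i < n" for i
      unfolding sample_max_def using that by (intro Max_ge) auto
    ultimately have "{i. i < n \<and> X i \<le> x} = {..<n}" by force
    then have "u = real n / real n" by (simp add: u_def ecdf_def)
    \<comment> \<open>The quotient is 0 for an empty sample, because division by zero gives 0, and 1
      otherwise; both contradict \<open>0 < u < 1\<close>.\<close>
    with xu show False by (cases "n = 0") auto
  qed
  with x xu show ?thesis
    by (auto simp: S_two_def less_SUP_iff u_def intro!: bexI[of _ x])
qed

lemma measurable_ecdf [measurable]:
  assumes "\<And>i. i < n \<Longrightarrow> sets (M i) = sets borel"
  shows "(\<lambda>X. ecdf n X x) \<in> borel_measurable (\<Pi>\<^sub>M i\<in>{..<n}. M i)"
proof -
  have "ecdf n X x = (\<Sum>i<n. indicator {..x} (X i)) / real n" for X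
    by (auto simp: ecdf_def indicator_def sum.If_cases Int_def)
  moreover have "(\<lambda>X. (\<Sum>i<n. indicator {..x} (X i)) / real n) \<in> borel_measurable (\<Pi>\<^sub>M i\<in>{..<n}. M i)"
    using assms
    by (intro borel_measurable_divide borel_measurable_sum borel_measurable_const
          measurable_compose[OF measurable_component_singleton borel_measurable_indicator]) auto
  ultimately show ?thesis by simp
qed

lemma measurable_K_plus [measurable]: "(\<lambda>u. K_plus s u v) \<in> borel_measurable borel"
proof -
  have "(\<lambda>u. K s u v) \<in> borel_measurable borel"
    by (cases "s = 0 \<or> s = 1") (auto simp: K_def[abs_def] K1_def)
  then show ?thesis unfolding K_plus_def by measurable
qed

lemma sets_S_plus_greater:
  assumes "\<And>i. i < n \<Longrightarrow> sets (M i) = sets borel" "0 \<le> c"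
  defines "P \<equiv> \<Pi>\<^sub>M i\<in>{..<n}. M i"
  shows "{X\<in>space P. ereal c < S_plus s n X} \<in> sets P"
proof -
  have [measurable]: "(\<lambda>X. ecdf n X x) \<in> borel_measurable P" for x
    unfolding P_def by (rule measurable_ecdf) (use assms in auto)
  have "{X\<in>space P. ereal c < S_plus s n X} =
      (\<Union>x\<in>\<rat> \<inter> {..1/2}. {X\<in>space P. c < K_plus s (ecdf n X x) x})"
    using S_plus_greater_iff[OF assms(2)] by auto
  also have "\<dots> \<in> sets P"
    by (intro sets.countable_UN'' countable_Int1 countable_rat) measurable
  finally show ?thesis .
qed

section \<open>Product measures\<close>

lemma PiM_density:
  assumes "prob_space M" "finite I" and [measurable]: "f \<in> borel_measurable M"
    and nn: "\<And>x. 0 \<le> f x" and "prob_space (density M (\<lambda>x. ennreal (f x)))"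
  shows "(\<Pi>\<^sub>M i\<in>I. density M (\<lambda>x. ennreal (f x))) =
    density (\<Pi>\<^sub>M i\<in>I. M) (\<lambda>X. ennreal (\<Prod>i\<in>I. f (X i)))"
proof -
  interpret M: prob_space M by fact
  interpret D: prob_space "density M (\<lambda>x. ennreal (f x))" by fact
  interpret PM: product_prob_space "\<lambda>_. M" I by unfold_locales
  interpret PD: product_prob_space "\<lambda>_. density M (\<lambda>x. ennreal (f x))" I by unfold_locales
  have [measurable]: "(\<lambda>X. \<Prod>i\<in>I. f (X i)) \<in> borel_measurable (\<Pi>\<^sub>M i\<in>I. M)"
    by (intro borel_measurable_prod measurable_compose[OF measurable_component_singleton]) auto
  show ?thesis
  proof (rule PD.PiM_eqI[symmetric])
    show "finite I" by fact
    show "sets (density (\<Pi>\<^sub>M i\<in>I. M) (\<lambda>X. ennreal (\<Prod>i\<in>I. f (X i)))) =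
        sets (\<Pi>\<^sub>M i\<in>I. density M (\<lambda>x. ennreal (f x)))"
      by (auto intro!: sets_PiM_cong)
  next
    fix A assume "\<And>i. i \<in> I \<Longrightarrow> A i \<in> sets (density M (\<lambda>x. ennreal (f x)))"
    then have A [measurable]: "\<And>i. i \<in> I \<Longrightarrow> A i \<in> sets M" by simp
    have meas: "Pi\<^sub>E I A \<in> sets (\<Pi>\<^sub>M i\<in>I. M)"
      using A by (intro sets_PiM_I_finite \<open>finite I\<close>) auto
    have "emeasure (density (\<Pi>\<^sub>M i\<in>I. M) (\<lambda>X. ennreal (\<Prod>i\<in>I. f (X i)))) (Pi\<^sub>E I A) =
      (\<integral>\<^sup>+X. ennreal (\<Prod>i\<in>I. f (X i)) * indicator (Pi\<^sub>E I A) X \<partial>(\<Pi>\<^sub>M i\<in>I. M))"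
      using meas by (subst emeasure_density) auto
    also have "\<dots> = (\<integral>\<^sup>+X. (\<Prod>i\<in>I. ennreal (f (X i)) * indicator (A i) (X i)) \<partial>(\<Pi>\<^sub>M i\<in>I. M))"
    proof (intro nn_integral_cong)
      fix X assume "X \<in> space (\<Pi>\<^sub>M i\<in>I. M)"
      then have X: "X \<in> extensional I" by (auto simp: space_PiM PiE_def)
      have "indicator (Pi\<^sub>E I A) X = (\<Prod>i\<in>I. indicator (A i) (X i) :: ennreal)"
      proof (cases "X \<in> Pi\<^sub>E I A")
        case True
        then have "(\<Prod>i\<in>I. indicator (A i) (X i) :: ennreal) = (\<Prod>i\<in>I. 1)"
          by (intro prod.cong) (auto simp: PiE_iff)
        with True show ?thesis by simp
      next
        case False
        then obtain i where "i \<in> I" "X i \<notin> A i" using X by (auto simp: PiE_def)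
        then have "(\<Prod>i\<in>I. indicator (A i) (X i) :: ennreal) = 0"
          using \<open>finite I\<close> by (intro prod_zero bexI[of _ i]) auto
        with False show ?thesis by simp
      qed
      then show "ennreal (\<Prod>i\<in>I. f (X i)) * indicator (Pi\<^sub>E I A) X =
          (\<Prod>i\<in>I. ennreal (f (X i)) * indicator (A i) (X i))"
        by (simp add: prod_ennreal nn prod.distrib)
    qed
    also have "\<dots> = (\<Prod>i\<in>I. \<integral>\<^sup>+x. ennreal (f x) * indicator (A i) x \<partial>M)"
      by (intro PM.product_nn_integral_prod \<open>finite I\<close>) measurable
    also have "\<dots> = (\<Prod>i\<in>I. emeasure (density M (\<lambda>x. ennreal (f x))) (A i))"
      by (intro prod.cong refl) (simp add: emeasure_density)
    finally show "emeasure (density (\<Pi>\<^sub>M i\<in>I. M) (\<lambda>X. ennreal (\<Prod>i\<in>I. f (X i)))) (Pi\<^sub>E I A) =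
      (\<Prod>i\<in>I. emeasure (density M (\<lambda>x. ennreal (f x))) (A i))" .
  qed
qed

text \<open>Under the product measure the square root of the likelihood ratio \<open>F\<close> has expectation
  \<open>\<rho> ^ n\<close> with \<open>\<rho> = E (sqrt f)\<close>, and \<open>F \<le> 2 (sqrt F - 1)\<^sup>2 + 2\<close>.\<close>

lemma PiM_density_measure_le:
  fixes n :: nat
  assumes "prob_space M" and [measurable]: "f \<in> borel_measurable M"
    and nn: "\<And>x. 0 \<le> f x" and int: "integrable M f" and f1: "(\<integral>x. f x \<partial>M) = 1"
    and A: "A \<in> sets (\<Pi>\<^sub>M i\<in>{..<n}. M)"
  shows "measure (\<Pi>\<^sub>M i\<in>{..<n}. density M (\<lambda>x. ennreal (f x))) A \<le>
    2 * real n * (\<integral>x. (sqrt (f x) - 1)\<^sup>2 \<partial>M) + 2 * measure (\<Pi>\<^sub>M i\<in>{..<n}. M) A"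
proof -
  interpret M: prob_space M by fact
  interpret PM: product_prob_space "\<lambda>_. M" "{..<n}" by unfold_locales
  let ?P = "\<Pi>\<^sub>M i\<in>{..<n}. M"
  have P1: "measure ?P (space ?P) = 1"
    by (intro prob_space.prob_space prob_space_PiM assms(1))
  define h where "h = (\<integral>x. (sqrt (f x) - 1)\<^sup>2 \<partial>M)"
  define F where "F X = (\<Prod>i<n. f (X i))" for X
  have D: "prob_space (density M (\<lambda>x. ennreal (f x)))"
    using nn int f1 by (intro prob_spaceI) (simp add: emeasure_density nn_integral_eq_integral)
  have [measurable]: "F \<in> borel_measurable ?P"
    unfolding F_def
    by (intro borel_measurable_prod measurable_compose[OF measurable_component_singleton]) auto
  have F0: "0 \<le> F X" for X
    unfolding F_def by (intro prod_nonneg) (auto simp: nn)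
  have intF: "integrable ?P F" and F1: "(\<integral>X. F X \<partial>?P) = 1"
    unfolding F_def using PM.product_integrable_prod[of "{..<n}" "\<lambda>_. f"]
      PM.product_integral_prod[of "{..<n}" "\<lambda>_. f"] int f1 by auto
  have ints: "integrable M (\<lambda>x. sqrt (f x))"
  proof (rule Bochner_Integration.integrable_bound)
    show "integrable M (\<lambda>x. 1 + f x)" using int by simp
    have "sqrt (f x) \<le> 1 + f x" for x
      using arith_geo_mean_sqrt[of 1 "f x"] nn[of x] by simp
    then show "AE x in M. norm (sqrt (f x)) \<le> norm (1 + f x)"
      using nn by (auto intro!: AE_I2)
  qed simp
  have "(sqrt (f x) - 1)\<^sup>2 = f x + 1 - 2 * sqrt (f x)" for x
    using nn[of x] by (simp add: power2_diff)
  then have h: "h = 2 - 2 * (\<integral>x. sqrt (f x) \<partial>M)"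
    unfolding h_def using int ints f1 by (simp add: M.prob_space)
  have h0: "0 \<le> h" unfolding h_def by (intro Bochner_Integration.integral_nonneg) auto
  have r0: "0 \<le> (\<integral>x. sqrt (f x) \<partial>M)" by (intro Bochner_Integration.integral_nonneg) (auto simp: nn)
  have sF: "sqrt (F X) = (\<Prod>i<n. sqrt (f (X i)))" for X
    unfolding F_def by (induction n) (auto simp: real_sqrt_mult)
  have intsF: "integrable ?P (\<lambda>X. sqrt (F X))"
    and sF1: "(\<integral>X. sqrt (F X) \<partial>?P) = (\<integral>x. sqrt (f x) \<partial>M) ^ n"
    unfolding sF using PM.product_integrable_prod[of "{..<n}" "\<lambda>_ x. sqrt (f x)"]
      PM.product_integral_prod[of "{..<n}" "\<lambda>_ x. sqrt (f x)"] ints by auto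
  \<comment> \<open>The affinity is \<open>1 - h / 2\<close>, so Bernoulli's inequality makes the
    squared Hellinger distance of the product at most \<open>n * h\<close>. It applies because the
    affinity is nonnegative.\<close>
  have "1 + real n * (- h / 2) \<le> (1 + (- h / 2)) ^ n"
    using h r0 by (intro Bernoulli_inequality) simp
  then have bern: "1 - n * h / 2 \<le> (\<integral>x. sqrt (f x) \<partial>M) ^ n"
    by (simp add: h diff_divide_distrib right_diff_distrib)
  have sq: "(sqrt (F X) - 1)\<^sup>2 = F X + 1 - 2 * sqrt (F X)" for X
    using F0[of X] by (simp add: power2_diff)
  have intsq: "integrable ?P (\<lambda>X. (sqrt (F X) - 1)\<^sup>2)"
    unfolding sq using intF intsF by simp
  have sq1: "(\<integral>X. (sqrt (F X) - 1)\<^sup>2 \<partial>?P) \<le> n * h"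
    unfolding sq using intF intsF F1 sF1 bern by (simp add: P1)
  have "measure (\<Pi>\<^sub>M i\<in>{..<n}. density M (\<lambda>x. ennreal (f x))) A = measure (density ?P (\<lambda>X. ennreal (F X))) A"
    unfolding F_def by (subst PiM_density) (use assms D in auto)
  also have "\<dots> = (\<integral>X. F X * indicator A X \<partial>?P)"
  proof -
    have "emeasure (density ?P (\<lambda>X. ennreal (F X))) A = (\<integral>\<^sup>+X. ennreal (F X * indicator A X) \<partial>?P)"
      using A by (subst emeasure_density) (auto simp: ennreal_mult' F0 ennreal_indicator intro!: nn_integral_cong)
    also have "\<dots> = ennreal (\<integral>X. F X * indicator A X \<partial>?P)"
      using A intF F0 by (intro nn_integral_eq_integral integrable_real_mult_indicator) auto
    finally show ?thesis
      unfolding measure_def using F0 by (simp add: Bochner_Integration.integral_nonneg)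
  qed
  also have "\<dots> \<le> (\<integral>X. 2 * (sqrt (F X) - 1)\<^sup>2 + 2 * indicator A X \<partial>?P)"
  proof (rule integral_mono)
    show "integrable ?P (\<lambda>X. F X * indicator A X)"
      using A intF by (intro integrable_real_mult_indicator)
    show "integrable ?P (\<lambda>X. 2 * (sqrt (F X) - 1)\<^sup>2 + 2 * indicator A X)"
      using intsq A by (auto simp: less_top[symmetric])
    fix X
    \<comment> \<open>Rearranged, this is \<open>(sqrt (F X) - 2)^2 \<ge> 0\<close>. On
      \<open>A\<close> the constant 2 is charged to the null probability; off \<open>A\<close> the
      left side of the target vanishes.\<close>
    have "F X \<le> 2 * (sqrt (F X) - 1)\<^sup>2 + 2"
      using zero_le_power2[of "sqrt (F X) - 2"] F0[of X] by (simp add: power2_diff)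
    then show "F X * indicator A X \<le> 2 * (sqrt (F X) - 1)\<^sup>2 + 2 * indicator A X"
      by (auto simp: indicator_def)
  qed
  also have "\<dots> = 2 * (\<integral>X. (sqrt (F X) - 1)\<^sup>2 \<partial>?P) + 2 * measure ?P A"
    using intsq A by (subst Bochner_Integration.integral_add) (auto simp: less_top[symmetric])
  also have "\<dots> \<le> 2 * (n * h) + 2 * measure ?P A"
    using sq1 by simp
  finally show ?thesis unfolding h_def by (simp add: mult_ac)
qed

text \<open>Chernoff's method. The success probability in the denominator of the exponent is
  essential: the probabilities of interest are negative powers of \<open>n\<close>, and a bound of
  the form \<open>exp (- 2 * t^2 / n)\<close> would be trivial at the deviations used.\<close>

lemma binomial_lower_tail:
  fixes n :: nat and p t :: real
  assumes "prob_space M" and [measurable]: "B \<in> sets M" and "0 < measure M B" "0 < n" "0 \<le> t"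
  defines "P \<equiv> \<Pi>\<^sub>M i\<in>{..<n}. M" and "p \<equiv> measure M B"
  shows "measure P {X\<in>space P. (\<Sum>i<n. indicator B (X i)) \<le> n * p - t} \<le> exp (- (t\<^sup>2 / (2 * real n * p)))"
proof -
  interpret M: prob_space M by fact
  interpret PM: product_prob_space "\<lambda>_. M" "{..<n}" by unfold_locales
  interpret P: prob_space P unfolding P_def by (intro prob_space_PiM assms(1))
  have p: "0 < p" using assms by simp
  \<comment> \<open>The minimiser of \<open>n * p * l^2 / 2 - l * t\<close>, the exponent obtained
    from \<open>exp (- l) \<le> 1 - l + l^2 / 2\<close>.\<close>
  define l where "l = t / (n * p)"
  have l: "0 \<le> l" using assms p by (simp add: l_def)
  define S where "S X = (\<Sum>i<n. indicator B (X i) :: real)" for X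
  have [measurable]: "S \<in> borel_measurable P"
    unfolding S_def P_def
    by (intro borel_measurable_sum measurable_compose[OF measurable_component_singleton]) auto
  have E1: "exp (- l * indicator B x) = 1 + (exp (- l) - 1) * indicator B x" for x
    by (auto simp: indicator_def)
  have intE: "integrable M (\<lambda>x. exp (- l * indicator B x))"
    unfolding E1 by (auto simp: less_top[symmetric])
  have EM: "(\<integral>x. exp (- l * indicator B x) \<partial>M) = 1 + (exp (- l) - 1) * p"
    unfolding E1 by (subst Bochner_Integration.integral_add) (auto simp: p_def M.prob_space less_top[symmetric])
  have prodE: "exp (- l * S X) = (\<Prod>i<n. exp (- l * indicator B (X i)))" for X
    by (simp add: S_def sum_distrib_left exp_sum)
  have intP: "integrable P (\<lambda>X. exp (- l * S X))"
    and EP: "(\<integral>X. exp (- l * S X) \<partial>P) = (1 + (exp (- l) - 1) * p) ^ n"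
    unfolding prodE P_def
    using PM.product_integrable_prod[of "{..<n}" "\<lambda>_ x. exp (- l * indicator B x)"]
      PM.product_integral_prod[of "{..<n}" "\<lambda>_ x. exp (- l * indicator B x)"] intE EM by auto
  have q: "exp (- l) \<le> 1 - l + l\<^sup>2 / 2"
  proof (cases "l = 0")
    case False
    define D :: "real \<Rightarrow> real" where "D = (\<lambda>x. 1 - x + x\<^sup>2 / 2 - exp (- x))"
    have "D 0 \<le> D l"
    proof (rule DERIV_nonneg_imp_nondecreasing[OF l])
      fix x :: real assume "0 \<le> x"
      have "(D has_real_derivative - 1 + x + exp (- x)) (at x)"
        unfolding D_def by (rule derivative_eq_intros refl | simp)+
      moreover have "0 \<le> - 1 + x + exp (- x)"
        using exp_ge_add_one_self[of "- x"] by simp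
      ultimately show "\<exists>y. (D has_real_derivative y) (at x) \<and> 0 \<le> y" by blast
    qed
    then show ?thesis by (simp add: D_def)
  qed simp
  have "(1 + (exp (- l) - 1) * p) ^ n \<le> exp ((- l + l\<^sup>2 / 2) * p) ^ n"
  proof (rule power_mono)
    have "1 + (exp (- l) - 1) * p \<le> 1 + (- l + l\<^sup>2 / 2) * p"
      using q p by (intro add_left_mono mult_right_mono) auto
    also have "\<dots> \<le> exp ((- l + l\<^sup>2 / 2) * p)" by (rule exp_ge_add_one_self)
    finally show "1 + (exp (- l) - 1) * p \<le> exp ((- l + l\<^sup>2 / 2) * p)" .
    show "0 \<le> 1 + (exp (- l) - 1) * p"
      unfolding EM[symmetric] by (intro Bochner_Integration.integral_nonneg) auto
  qed
  also have "\<dots> = exp (n * ((- l + l\<^sup>2 / 2) * p))"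
    by (simp add: exp_of_nat_mult)
  finally have EPle: "(\<integral>X. exp (- l * S X) \<partial>P) \<le> exp (n * ((- l + l\<^sup>2 / 2) * p))"
    unfolding EP .
  have "measure P {X\<in>space P. S X \<le> n * p - t} \<le> measure P {X\<in>space P. exp (- l * S X) \<ge> exp (- l * (n * p - t))}"
    using l by (intro P.finite_measure_mono) (auto intro: mult_left_mono)
  also have "\<dots> \<le> (\<integral>X. exp (- l * S X) \<partial>P) / exp (- l * (n * p - t))"
    using intP by (intro integral_Markov_inequality_measure[where A = "{}"]) auto
  also have "\<dots> \<le> exp (n * ((- l + l\<^sup>2 / 2) * p)) / exp (- l * (n * p - t))"
    using EPle by (intro divide_right_mono) auto
  also have "\<dots> = exp (n * ((- l + l\<^sup>2 / 2) * p) - - l * (n * p - t))"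
    by (simp only: exp_diff)
  also have "n * ((- l + l\<^sup>2 / 2) * p) - - l * (n * p - t) = - (t\<^sup>2 / (2 * real n * p))"
    using p \<open>0 < n\<close> by (simp add: l_def field_simps power2_eq_square)
  finally show ?thesis by (simp add: S_def)
qed

text \<open>\<open>K_plus\<close> is 0 where the empirical distribution function equals 1, so the
  event that every observation falls in the tested tail has to be excluded separately.\<close>

lemma binomial_all:
  fixes n :: nat
  assumes "prob_space M" and [measurable]: "B \<in> sets M"
  defines "P \<equiv> \<Pi>\<^sub>M i\<in>{..<n}. M"
  shows "measure P {X\<in>space P. \<forall>i<n. X i \<in> B} = measure M B ^ n"
proof -
  interpret M: prob_space M by fact
  interpret PM: product_prob_space "\<lambda>_. M" "{..<n}" by unfold_locales
  have "{X\<in>space P. \<forall>i<n. X i \<in> B} = Pi\<^sub>E {..<n} (\<lambda>_. B)"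
    using sets.sets_into_space[OF assms(2)] by (auto simp: P_def space_PiM PiE_def Pi_def)
  then have "emeasure P {X\<in>space P. \<forall>i<n. X i \<in> B} = ennreal (measure M B ^ n)"
    unfolding P_def by (simp add: PM.emeasure_PiM M.emeasure_eq_measure ennreal_power)
  then show ?thesis
    by (intro measure_eq_emeasure_eq_ennreal) auto
qed

section \<open>Normal tails and the law of the alternative\<close>

text \<open>This is also the map from the normal scale to the unit interval. It is decreasing, and
  the closed ray makes \<open>normal_tail y \<le> normal_tail z\<close> the event that
  \<open>y\<close> lies in \<open>{z..}\<close>.\<close>

definition normal_tail :: "real \<Rightarrow> real" where
  "normal_tail y = measure std_normal_distribution {y..}"

lemma emeasure_std_normal_singleton: "emeasure std_normal_distribution {x} = 0"
proof -
  have "AE y in lborel. y \<notin> {x}"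
    by (intro AE_not_in) (simp add: null_sets_def)
  then show ?thesis
    by (subst emeasure_density) (auto intro!: nn_integral_zero' simp: indicator_def)
qed

lemma std_normal_cdf_eq: "std_normal_cdf y = 1 - normal_tail y"
proof -
  interpret N: real_distribution std_normal_distribution by (rule real_dist_normal_dist)
  have "measure std_normal_distribution (UNIV - {..y}) = 1 - measure std_normal_distribution {..y}"
    using N.prob_compl[of "{..y}"] by simp
  also have "UNIV - {..y} = {y..} - {y}" by auto
  also have "measure std_normal_distribution ({y..} - {y}) = normal_tail y"
    unfolding normal_tail_def by (rule measure_Diff_null_set) (auto simp: null_sets_def emeasure_std_normal_singleton)
  finally show ?thesis by (simp add: std_normal_cdf_def cdf_def)
qed

lemma isCont_std_normal_cdf: "isCont std_normal_cdf x"
proof -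
  interpret N: real_distribution std_normal_distribution by (rule real_dist_normal_dist)
  show ?thesis
    unfolding std_normal_cdf_def N.isCont_cdf by (simp add: measure_def emeasure_std_normal_singleton)
qed

lemma std_normal_density_times_exp:
  "std_normal_density y * exp (m * y - m\<^sup>2 / 2) = normal_density m 1 y"
proof -
  have "std_normal_density y * exp (m * y - m\<^sup>2 / 2) =
      1 / sqrt (2 * pi) * (exp (- y\<^sup>2 / 2) * exp (m * y - m\<^sup>2 / 2))"
    by (simp add: std_normal_density_def)
  also have "\<dots> = 1 / sqrt (2 * pi) * exp (- (y - m)\<^sup>2 / 2)"
    by (simp add: exp_add[symmetric] power2_eq_square algebra_simps add_divide_distrib diff_divide_distrib)
  finally show ?thesis by (simp add: normal_density_def)
qed

lemma density_std_normal_exp: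
  "density std_normal_distribution (\<lambda>y. ennreal (exp (m * y - m\<^sup>2 / 2))) =
    density lborel (\<lambda>y. ennreal (normal_density m 1 y))"
  by (subst density_density_eq)
    (auto simp: ennreal_mult'[symmetric] std_normal_density_times_exp)

lemma measure_normal_atLeast:
  "measure (density lborel (\<lambda>y. ennreal (normal_density m 1 y))) {z..} = normal_tail (z - m)"
proof -
  have shift: "ennreal (normal_density m 1 (m + 1 * y)) * indicator {z..} (m + 1 * y) =
      ennreal (std_normal_density y) * indicator {z - m..} y" for y
  proof -
    have "normal_density m 1 (m + 1 * y) = std_normal_density y"
      by (simp add: normal_density_def)
    moreover have "indicator {z..} (m + 1 * y) = (indicator {z - m..} y :: ennreal)"
      by (simp add: indicator_def algebra_simps)
    ultimately show ?thesis by (simp only:)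
  qed
  have "emeasure (density lborel (\<lambda>y. ennreal (normal_density m 1 y))) {z..} =
      (\<integral>\<^sup>+y. ennreal (normal_density m 1 y) * indicator {z..} y \<partial>lborel)"
    by (rule emeasure_density) measurable
  also have "\<dots> = ennreal \<bar>1\<bar> * (\<integral>\<^sup>+y. ennreal (normal_density m 1 (m + 1 * y)) * indicator {z..} (m + 1 * y) \<partial>lborel)"
    by (rule nn_integral_real_affine) auto
  also have "\<dots> = (\<integral>\<^sup>+y. ennreal (std_normal_density y) * indicator {z - m..} y \<partial>lborel)"
    unfolding shift by simp
  also have "\<dots> = emeasure std_normal_distribution {z - m..}"
    by (rule emeasure_density[symmetric]) auto
  finally show ?thesis by (simp only: measure_def normal_tail_def)
qed

lemma
  shows integrable_exp_std_normal: "integrable std_normal_distribution (\<lambda>y. exp (a * y))"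
    and integral_exp_std_normal: "(\<integral>y. exp (a * y) \<partial>std_normal_distribution) = exp (a\<^sup>2 / 2)"
proof -
  have *: "std_normal_density y * exp (a * y) = exp (a\<^sup>2 / 2) * normal_density a 1 y" for y
    by (simp add: std_normal_density_times_exp[of y a, symmetric] exp_diff)
  show "integrable std_normal_distribution (\<lambda>y. exp (a * y))"
    by (subst integrable_density) (auto simp: *)
  show "(\<integral>y. exp (a * y) \<partial>std_normal_distribution) = exp (a\<^sup>2 / 2)"
    by (subst integral_density) (auto simp: *)
qed

lemma normal_tail_le:
  assumes "0 \<le> y"
  shows "normal_tail y \<le> exp (- y\<^sup>2 / 2)"
proof -
  interpret N: real_distribution std_normal_distribution by (rule real_dist_normal_dist)
  have eq: "exp (y * x - y\<^sup>2) = exp (- y\<^sup>2) * exp (y * x)" for x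
    by (simp add: exp_diff exp_minus divide_inverse)
  have "normal_tail y = (\<integral>x. indicator {y..} x \<partial>std_normal_distribution)"
    by (simp add: normal_tail_def)
  also have "\<dots> \<le> (\<integral>x. exp (y * x - y\<^sup>2) \<partial>std_normal_distribution)"
  proof (rule integral_mono)
    show "integrable std_normal_distribution (\<lambda>x. exp (y * x - y\<^sup>2))"
      unfolding eq using integrable_exp_std_normal by simp
    \<comment> \<open>Exponential Markov bound with tilt \<open>y\<close>, the optimal one: on the
      ray the exponent \<open>y * (x - y)\<close> is nonnegative.\<close>
    show "indicator {y..} x \<le> exp (y * x - y\<^sup>2)" for x
      using assms mult_left_mono[of y x y] by (auto simp: indicator_def power2_eq_square)
  qed (auto simp: less_top[symmetric])
  also have "\<dots> = exp (- y\<^sup>2) * exp (y\<^sup>2 / 2)"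
    unfolding eq by (simp add: integral_exp_std_normal)
  also have "\<dots> = exp (- y\<^sup>2 / 2)"
    by (simp add: exp_add[symmetric])
  finally show ?thesis .
qed

lemma std_normal_interval_ge:
  assumes "x \<le> y" "0 \<le> c" "\<And>t. x < t \<Longrightarrow> t \<le> y \<Longrightarrow> c \<le> std_normal_density t"
  shows "c * (y - x) \<le> measure std_normal_distribution {x<..y}"
proof -
  interpret N: real_distribution std_normal_distribution by (rule real_dist_normal_dist)
  have "ennreal (c * (y - x)) = (\<integral>\<^sup>+t. ennreal c * indicator {x<..y} t \<partial>lborel)"
    using assms by (simp add: nn_integral_cmult_indicator ennreal_mult')
  also have "\<dots> \<le> (\<integral>\<^sup>+t. ennreal (std_normal_density t) * indicator {x<..y} t \<partial>lborel)"
    using assms(3) by (intro nn_integral_mono) (auto simp: indicator_def intro!: ennreal_leI)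
  also have "\<dots> = emeasure std_normal_distribution {x<..y}"
    by (rule emeasure_density[symmetric]) auto
  also have "\<dots> = ennreal (measure std_normal_distribution {x<..y})"
    by (rule N.emeasure_eq_measure)
  finally show ?thesis by simp
qed

text \<open>The density decreases on the positive axis, so its value at \<open>z + 1\<close> bounds
  the mass of the unit interval after \<open>z\<close>. The loss is of order
  \<open>exp (O (z))\<close>, which is subpolynomial in \<open>n\<close> at the levels used.\<close>

lemma normal_tail_ge:
  assumes "0 \<le> z"
  shows "std_normal_density (z + 1) \<le> normal_tail z"
proof -
  interpret N: real_distribution std_normal_distribution by (rule real_dist_normal_dist)
  have "std_normal_density (z + 1) * (z + 1 - z) \<le> measure std_normal_distribution {z<..z + 1}"
    using assms by (intro std_normal_interval_ge)
      (auto simp: std_normal_density_def intro!: divide_right_mono power_mono)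
  also have "\<dots> \<le> normal_tail z"
    unfolding normal_tail_def by (intro N.finite_measure_mono) auto
  finally show ?thesis by simp
qed

lemma strict_mono_std_normal_cdf: "strict_mono std_normal_cdf"
proof (rule strict_monoI)
  fix x y :: real assume "x < y"
  interpret N: real_distribution std_normal_distribution by (rule real_dist_normal_dist)
  \<comment> \<open>The sum of the two squares bounds \<open>t^2\<close> on the whole interval
    whatever the signs of its ends, giving a positive lower bound for the density.\<close>
  have "exp (- (x\<^sup>2 + y\<^sup>2) / 2) / sqrt (2 * pi) * (y - x) \<le> measure std_normal_distribution {x<..y}"
  proof (rule std_normal_interval_ge)
    fix t assume t: "x < t" "t \<le> y"
    have "t\<^sup>2 \<le> x\<^sup>2 + y\<^sup>2"
    proof (cases "0 \<le> t")
      case True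
      then have "t\<^sup>2 \<le> y\<^sup>2" using t by (intro power_mono) auto
      then show ?thesis using zero_le_power2[of x] by linarith
    next
      case False
      then have "(- t)\<^sup>2 \<le> (- x)\<^sup>2" using t by (intro power_mono) auto
      then show ?thesis using zero_le_power2[of y] by (simp add: add_increasing2)
    qed
    then show "exp (- (x\<^sup>2 + y\<^sup>2) / 2) / sqrt (2 * pi) \<le> std_normal_density t"
      by (auto simp: std_normal_density_def intro!: divide_right_mono)
  qed (use \<open>x < y\<close> in auto)
  moreover have "0 < exp (- (x\<^sup>2 + y\<^sup>2) / 2) / sqrt (2 * pi) * (y - x)"
    using \<open>x < y\<close> by (intro mult_pos_pos divide_pos_pos) auto
  ultimately show "std_normal_cdf x < std_normal_cdf y"
    using N.cdf_diff_eq[OF \<open>x < y\<close>] unfolding std_normal_cdf_def by linarith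
qed

lemma normal_tail_le_iff [simp]: "normal_tail x \<le> normal_tail y \<longleftrightarrow> y \<le> x"
  using strict_mono_less_eq[OF strict_mono_std_normal_cdf, of y x] by (simp add: std_normal_cdf_eq)

lemma normal_tail_less_iff [simp]: "normal_tail x < normal_tail y \<longleftrightarrow> y < x"
  using strict_mono_less[OF strict_mono_std_normal_cdf, of y x] by (simp add: std_normal_cdf_eq)

lemma normal_tail_pos [simp]: "0 < normal_tail x"
proof -
  have "0 \<le> normal_tail (x + 1)" by (simp add: normal_tail_def)
  also have "\<dots> < normal_tail x" by simp
  finally show ?thesis .
qed

lemma normal_tail_less_1 [simp]: "normal_tail x < 1"
proof -
  interpret N: real_distribution std_normal_distribution by (rule real_dist_normal_dist)
  have "normal_tail x < normal_tail (x - 1)" by simp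
  also have "\<dots> \<le> 1" by (simp add: normal_tail_def)
  finally show ?thesis .
qed

text \<open>\<open>inv\<close> returns a preimage only for values in the range; the intermediate
  value theorem places the whole open unit interval there.\<close>

lemma std_normal_cdf_inv:
  assumes "0 < p" "p < 1"
  shows "std_normal_cdf (inv std_normal_cdf p) = p"
proof -
  interpret N: real_distribution std_normal_distribution by (rule real_dist_normal_dist)
  have "\<forall>\<^sub>F x in at_bot. std_normal_cdf x < p" "\<forall>\<^sub>F x in at_top. p < std_normal_cdf x"
    using order_tendstoD[OF N.cdf_lim_at_bot] order_tendstoD[OF N.cdf_lim_at_top_prob] assms
    by (auto simp: std_normal_cdf_def)
  then obtain a b where ab: "std_normal_cdf a < p" "p < std_normal_cdf b"
    using eventually_happens'[OF trivial_limit_at_bot_linorder] eventually_happens'[OF trivial_limit_at_top_linorder]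
    by metis
  then have "a \<le> b"
    using strict_mono_less[OF strict_mono_std_normal_cdf, of a b] by linarith
  then have "\<exists>x\<ge>a. x \<le> b \<and> std_normal_cdf x = p"
    using ab isCont_std_normal_cdf
    by (intro IVT') (auto intro!: continuous_at_imp_continuous_on)
  then have "p \<in> range std_normal_cdf" by blast
  then show ?thesis by (rule f_inv_into_f)
qed

lemma measurable_normal_tail [measurable]: "normal_tail \<in> borel_measurable borel"
proof -
  have [measurable]: "std_normal_cdf \<in> borel_measurable borel"
    using isCont_std_normal_cdf by (intro borel_measurable_continuous_onI continuous_at_imp_continuous_on) auto
  have "(\<lambda>x. 1 - std_normal_cdf x) \<in> borel_measurable borel"
    by measurable
  then show ?thesis by (simp add: std_normal_cdf_eq)
qed

text \<open>The case distinction is that of \<open>H1_cdf\<close>, so that laws on the unit interval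
  can be identified with images of laws on the normal scale by comparing distribution
  functions.\<close>

lemma cdf_distr_normal_tail:
  assumes "real_distribution M"
  shows "cdf (distr M borel normal_tail) u =
    (if u \<le> 0 then 0 else if 1 \<le> u then 1 else measure M {inv std_normal_cdf (1 - u)..})"
proof -
  interpret M: real_distribution M by fact
  have *: "cdf (distr M borel normal_tail) u = measure M {y. normal_tail y \<le> u}"
    by (simp add: cdf_def measure_distr vimage_def)
  consider "u \<le> 0" | "1 \<le> u" | "0 < u" "u < 1" by linarith
  then show ?thesis
  proof cases
    case 1
    then have "{y. normal_tail y \<le> u} = {}"
      using le_less_trans[OF _ normal_tail_pos] by (auto simp: not_le)
    with 1 show ?thesis by (simp add: *)
  next
    case 2
    then have "{y. normal_tail y \<le> u} = UNIV"
      using less_le_trans[OF normal_tail_less_1] by (auto intro: less_imp_le)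
    with 2 show ?thesis using M.prob_space by (simp add: *)
  next
    case 3
    define z where "z = inv std_normal_cdf (1 - u)"
    have "normal_tail z = u"
      using std_normal_cdf_inv[of "1 - u"] 3 by (simp add: z_def std_normal_cdf_eq)
    then have "{y. normal_tail y \<le> u} = {z..}" by auto
    with 3 show ?thesis by (simp add: * z_def)
  qed
qed

lemma uniform_eq_distr_normal_tail:
  "uniform_measure lborel {0..1} = distr std_normal_distribution borel normal_tail"
proof (rule cdf_unique)
  interpret N: real_distribution std_normal_distribution by (rule real_dist_normal_dist)
  interpret U: prob_space "uniform_measure lborel {0..1::real}"
    by (rule prob_space_uniform_measure) auto
  show "real_distribution (distr std_normal_distribution borel normal_tail)"
    by (intro N.real_distribution_distr) simp
  show "real_distribution (uniform_measure lborel {0..1})"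
    by unfold_locales simp
  show "cdf (uniform_measure lborel {0..1}) = cdf (distr std_normal_distribution borel normal_tail)"
  proof
    fix u :: real
    have "cdf (uniform_measure lborel {0..1}) u = measure lborel ({0..1} \<inter> {..u})"
      by (simp add: cdf_def)
    also have "{0..1} \<inter> {..u} = {0..min 1 u}" by auto
    also have "measure lborel {0..min 1 u} = (if u \<le> 0 then 0 else if 1 \<le> u then 1 else u)"
      by auto
    also have "\<dots> = cdf (distr std_normal_distribution borel normal_tail) u"
      using std_normal_cdf_inv[of "1 - u"]
      by (simp add: cdf_distr_normal_tail[OF real_dist_normal_dist] normal_tail_def[symmetric] std_normal_cdf_eq)
    finally show "cdf (uniform_measure lborel {0..1}) u = cdf (distr std_normal_distribution borel normal_tail) u" .
  qed
qed

section \<open>The normal mixture and its image on the unit interval\<close>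

definition mix_density :: "real \<Rightarrow> real \<Rightarrow> real \<Rightarrow> real" where
  "mix_density e m y = 1 + e * (exp (m * y - m\<^sup>2 / 2) - 1)"

definition normal_mix :: "real \<Rightarrow> real \<Rightarrow> real measure" where
  "normal_mix e m = density std_normal_distribution (\<lambda>y. ennreal (mix_density e m y))"

lemma mix_density_nonneg:
  assumes "0 \<le> e" "e \<le> 1"
  shows "0 \<le> mix_density e m y"
proof -
  have "mix_density e m y = (1 - e) + e * exp (m * y - m\<^sup>2 / 2)"
    by (simp add: mix_density_def algebra_simps)
  with assms show ?thesis by simp
qed

lemma measurable_mix_density [measurable]: "mix_density e m \<in> borel_measurable borel"
  unfolding mix_density_def[abs_def] by measurable

lemma integrable_mix_density: "integrable std_normal_distribution (mix_density e m)"
  and integral_mix_density: "(\<integral>y. mix_density e m y \<partial>std_normal_distribution) = 1"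
proof -
  interpret N: real_distribution std_normal_distribution by (rule real_dist_normal_dist)
  have *: "mix_density e m = (\<lambda>y. (1 - e) + e * (exp (- (m\<^sup>2 / 2)) * exp (m * y)))"
    by (simp add: mix_density_def fun_eq_iff exp_add[symmetric] algebra_simps)
  show "integrable std_normal_distribution (mix_density e m)"
    unfolding * using integrable_exp_std_normal by simp
  have "(\<integral>y. mix_density e m y \<partial>std_normal_distribution) = (1 - e) + e * (exp (- (m\<^sup>2 / 2)) * exp (m\<^sup>2 / 2))"
    unfolding * using integrable_exp_std_normal integral_exp_std_normal N.prob_space by simp
  then show "(\<integral>y. mix_density e m y \<partial>std_normal_distribution) = 1"
    by (simp add: exp_add[symmetric])
qed

lemma real_distribution_normal_mix:
  assumes "0 \<le> e" "e \<le> 1"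
  shows "real_distribution (normal_mix e m)"
proof -
  have "prob_space (normal_mix e m)"
    unfolding normal_mix_def
    using mix_density_nonneg[OF assms] integrable_mix_density integral_mix_density
    by (intro prob_spaceI) (simp add: emeasure_density nn_integral_eq_integral)
  then show ?thesis
    by (auto simp: real_distribution_def real_distribution_axioms_def normal_mix_def)
qed

lemma measure_normal_mix_atLeast:
  assumes "0 \<le> e" "e \<le> 1"
  shows "measure (normal_mix e m) {z..} = normal_tail z + e * (normal_tail (z - m) - normal_tail z)"
proof -
  interpret N: real_distribution std_normal_distribution by (rule real_dist_normal_dist)
  interpret M: prob_space "density lborel (\<lambda>y. ennreal (normal_density m 1 y))"
    by (rule prob_space_normal_density) simp
  have "emeasure (normal_mix e m) {z..} =
      (\<integral>\<^sup>+y. ennreal (mix_density e m y) * indicator {z..} y \<partial>std_normal_distribution)"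
    unfolding normal_mix_def by (rule emeasure_density) auto
  also have "\<dots> = (\<integral>\<^sup>+y. ennreal (1 - e) * indicator {z..} y +
      ennreal e * (ennreal (exp (m * y - m\<^sup>2 / 2)) * indicator {z..} y) \<partial>std_normal_distribution)"
  proof (intro nn_integral_cong)
    fix y
    have "ennreal (mix_density e m y) = ennreal (1 - e) + ennreal e * ennreal (exp (m * y - m\<^sup>2 / 2))"
      using assms by (simp add: mix_density_def ennreal_mult[symmetric] ennreal_plus[symmetric] algebra_simps
          del: ennreal_plus)
    then show "ennreal (mix_density e m y) * indicator {z..} y = ennreal (1 - e) * indicator {z..} y +
      ennreal e * (ennreal (exp (m * y - m\<^sup>2 / 2)) * indicator {z..} y)"
      by (simp add: distrib_right mult.assoc)
  qed
  also have "\<dots> = ennreal (1 - e) * emeasure std_normal_distribution {z..} +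
      ennreal e * emeasure (density std_normal_distribution (\<lambda>y. ennreal (exp (m * y - m\<^sup>2 / 2)))) {z..}"
    by (subst nn_integral_add) (auto simp: nn_integral_cmult emeasure_density)
  also have "\<dots> = ennreal (1 - e) * ennreal (normal_tail z) + ennreal e * ennreal (normal_tail (z - m))"
    unfolding density_std_normal_exp measure_normal_atLeast[symmetric]
    by (simp add: normal_tail_def N.emeasure_eq_measure M.emeasure_eq_measure)
  also have "\<dots> = ennreal ((1 - e) * normal_tail z + e * normal_tail (z - m))"
    using assms by (simp add: ennreal_mult ennreal_plus less_imp_le)
  finally have "measure (normal_mix e m) {z..} = (1 - e) * normal_tail z + e * normal_tail (z - m)"
    using assms by (intro measure_eq_emeasure_eq_ennreal) (auto intro!: add_nonneg_nonneg mult_nonneg_nonneg simp: less_imp_le)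
  then show ?thesis by (simp add: algebra_simps)
qed

lemma eps_nonneg: "0 \<le> eps \<beta> n"
  by (simp add: eps_def)

lemma eps_le_1: "0 < \<beta> \<Longrightarrow> eps \<beta> n \<le> 1"
  using powr_mono[of "- \<beta>" 0 "real n"] by (cases "n = 0") (auto simp: eps_def)

text \<open>Recognising \<open>H1_cdf\<close> as the distribution function of an explicit law yields
  at once the monotonicity, right continuity and limits under which \<open>interval_measure\<close>
  has this distribution function.\<close>

lemma interval_measure_H1_cdf:
  assumes "0 < \<beta>"
  shows "interval_measure (H1_cdf \<beta> r n) = distr (normal_mix (eps \<beta> n) (mu r n)) borel normal_tail"
proof -
  let ?M = "normal_mix (eps \<beta> n) (mu r n)"
  have M: "real_distribution ?M"
    by (intro real_distribution_normal_mix eps_nonneg eps_le_1 assms)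
  interpret M: real_distribution ?M by fact
  interpret D: real_distribution "distr ?M borel normal_tail"
    by (intro M.real_distribution_distr) simp
  have "H1_cdf \<beta> r n = cdf (distr ?M borel normal_tail)"
  proof
    fix u
    define z where "z = inv std_normal_cdf (1 - u)"
    show "H1_cdf \<beta> r n u = cdf (distr ?M borel normal_tail) u"
    proof (cases "0 < u \<and> u < 1")
      case True
      then have "normal_tail z = u"
        using std_normal_cdf_inv[of "1 - u"] by (simp add: z_def std_normal_cdf_eq)
      then show ?thesis
        using True assms by (simp add: H1_cdf_def cdf_distr_normal_tail[OF M] z_def[symmetric]
            measure_normal_mix_atLeast eps_nonneg eps_le_1 std_normal_cdf_eq)
    qed (auto simp: H1_cdf_def cdf_distr_normal_tail[OF M])
  qed
  moreover have "interval_measure (cdf (distr ?M borel normal_tail)) = distr ?M borel normal_tail"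
  proof (rule cdf_unique)
    show "real_distribution (interval_measure (cdf (distr ?M borel normal_tail)))"
      by (intro real_distribution_interval_measure D.cdf_nondecreasing D.cdf_is_right_cont
            D.cdf_lim_at_bot D.cdf_lim_at_top_prob)
    show "cdf (interval_measure (cdf (distr ?M borel normal_tail))) = cdf (distr ?M borel normal_tail)"
      by (intro cdf_interval_measure D.cdf_nondecreasing D.cdf_is_right_cont D.cdf_lim_at_bot)
  qed (rule D.real_distribution_axioms)
  ultimately show ?thesis by (simp only:)
qed

section \<open>Below the boundary\<close>

lemma PiM_distr_borel:
  fixes n :: nat and f :: "real \<Rightarrow> real"
  assumes "real_distribution M" and [measurable]: "f \<in> borel_measurable borel"
  shows "(\<Pi>\<^sub>M i\<in>{..<n}. distr M borel f) =
    distr (\<Pi>\<^sub>M i\<in>{..<n}. M) (\<Pi>\<^sub>M i\<in>{..<n}. borel) (compose {..<n} f)"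
proof -
  interpret M: real_distribution M by fact
  have "distr (\<Pi>\<^sub>M i\<in>{..<n}. M) (\<Pi>\<^sub>M i\<in>{..<n}. borel) (compose {..<n} f) =
      distr (\<Pi>\<^sub>M i\<in>{..<n}. M) (\<Pi>\<^sub>M i\<in>{..<n}. M) (compose {..<n} f)"
    by (intro distr_cong refl sets_PiM_cong) auto
  also have "\<dots> = (\<Pi>\<^sub>M i\<in>{..<n}. distr M M f)"
    by (intro distr_PiM_finite_prob_space') (auto intro: M.prob_space_axioms)
  also have "\<dots> = (\<Pi>\<^sub>M i\<in>{..<n}. distr M borel f)"
    by (intro PiM_cong distr_cong refl) auto
  finally show ?thesis by simp
qed

text \<open>The set is cut out of the Borel product space, not of the space of a particular law, so
  one and the same set is measured under both hypotheses.\<close>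

definition rejection :: "real \<Rightarrow> nat \<Rightarrow> real \<Rightarrow> (nat \<Rightarrow> real) set" where
  "rejection s n c = {Y \<in> space (\<Pi>\<^sub>M i\<in>{..<n}. borel). ereal c < S_plus s n (compose {..<n} normal_tail Y)}"

lemma measurable_compose_normal_tail:
  "compose {..<n::nat} normal_tail \<in> (\<Pi>\<^sub>M i\<in>{..<n}. borel) \<rightarrow>\<^sub>M (\<Pi>\<^sub>M i\<in>{..<n}. borel)"
  unfolding compose_def[abs_def]
  by (intro measurable_restrict measurable_compose[OF measurable_component_singleton]) auto

lemma rejection_eq_vimage:
  "rejection s n c = compose {..<n} normal_tail -`
      {X\<in>space (\<Pi>\<^sub>M i\<in>{..<n}. borel). ereal c < S_plus s n X} \<inter> space (\<Pi>\<^sub>M i\<in>{..<n}. borel)"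
  by (auto simp: rejection_def space_PiM compose_def)

lemma sets_rejection:
  assumes "0 \<le> c" "sets M = sets borel"
  shows "rejection s n c \<in> sets (\<Pi>\<^sub>M i\<in>{..<n}. M)"
proof -
  have "rejection s n c \<in> sets (\<Pi>\<^sub>M i\<in>{..<n}. borel)"
    unfolding rejection_eq_vimage
    by (intro measurable_sets[OF measurable_compose_normal_tail] sets_S_plus_greater assms(1)) auto
  also have "sets (\<Pi>\<^sub>M i\<in>{..<n}. borel) = sets (\<Pi>\<^sub>M i\<in>{..<n}. M)"
    by (intro sets_PiM_cong) (auto simp: assms)
  finally show ?thesis .
qed

lemma measure_rejection:
  fixes n :: nat
  assumes M: "real_distribution M" and "0 \<le> c"
  defines "P \<equiv> \<Pi>\<^sub>M i\<in>{..<n}. distr M borel normal_tail"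
  shows "measure P {X\<in>space P. ereal c < S_plus s n X} = measure (\<Pi>\<^sub>M i\<in>{..<n}. M) (rejection s n c)"
proof -
  interpret M: real_distribution M by fact
  have sets: "sets (\<Pi>\<^sub>M i\<in>{..<n}. M) = sets (\<Pi>\<^sub>M i\<in>{..<n}. borel)"
    by (intro sets_PiM_cong) auto
  have space: "space (\<Pi>\<^sub>M i\<in>{..<n}. M) = space (\<Pi>\<^sub>M i\<in>{..<n}. borel)"
    by (rule sets_eq_imp_space_eq) (rule sets)
  have P: "P = distr (\<Pi>\<^sub>M i\<in>{..<n}. M) (\<Pi>\<^sub>M i\<in>{..<n}. borel) (compose {..<n} normal_tail)"
    unfolding P_def by (intro PiM_distr_borel M) simp
  have "compose {..<n} normal_tail \<in> (\<Pi>\<^sub>M i\<in>{..<n}. M) \<rightarrow>\<^sub>M (\<Pi>\<^sub>M i\<in>{..<n}. borel)"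
    using measurable_compose_normal_tail[of n] measurable_cong_sets[OF sets refl] by blast
  moreover have "{X\<in>space (\<Pi>\<^sub>M i\<in>{..<n}. borel). ereal c < S_plus s n X} \<in> sets (\<Pi>\<^sub>M i\<in>{..<n}. borel)"
    by (intro sets_S_plus_greater \<open>0 \<le> c\<close>) simp
  ultimately show ?thesis
    unfolding P rejection_eq_vimage space[symmetric] by (simp add: measure_distr space)
qed

lemma power_plus_eq:
  assumes "0 < \<beta>" "0 \<le> c"
  shows "power_plus s \<beta> r n c =
    measure (\<Pi>\<^sub>M i\<in>{..<n}. normal_mix (eps \<beta> n) (mu r n)) (rejection s n c)"
  unfolding power_plus_def H1_law_def interval_measure_H1_cdf[OF assms(1)]
  by (intro measure_rejection real_distribution_normal_mix eps_nonneg eps_le_1 assms)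

lemma measure_rejection_null_le:
  assumes "is_quantile s n a q" "a < 1" "0 \<le> q"
  shows "measure (\<Pi>\<^sub>M i\<in>{..<n}. std_normal_distribution) (rejection s n q) \<le> a"
proof -
  let ?P = "H0_law n"
  have P: "?P = (\<Pi>\<^sub>M i\<in>{..<n}. distr std_normal_distribution borel normal_tail)"
    by (simp add: H0_law_def uniform_eq_distr_normal_tail)
  interpret P: prob_space ?P
    unfolding H0_law_def by (intro prob_space_PiM prob_space_uniform_measure) auto
  define A where "A = {X\<in>space ?P. S_two s n X \<le> ereal q}"
  have A: "measure ?P A = 1 - a" using assms by (simp add: is_quantile_def A_def)
  \<comment> \<open>A set that is not measurable has measure 0, whereas the quantile equation gives
    the positive value \<open>1 - a\<close>; so the quantile equation itself yields
    measurability.\<close>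
  then have "A \<in> sets ?P" using assms(2) measure_notin_sets[of A ?P] by linarith
  have "measure (\<Pi>\<^sub>M i\<in>{..<n}. std_normal_distribution) (rejection s n q) =
      measure ?P {X\<in>space ?P. ereal q < S_plus s n X}"
    unfolding P by (intro measure_rejection[symmetric] real_dist_normal_dist assms)
  also have "\<dots> \<le> measure ?P (space ?P - A)"
    using S_two_greater[OF assms(3), of s n] \<open>A \<in> sets ?P\<close>
    by (intro P.finite_measure_mono) (auto simp: A_def not_le[symmetric])
  also have "\<dots> = a"
    using P.prob_compl[OF \<open>A \<in> sets ?P\<close>] A by simp
  finally show ?thesis .
qed

section \<open>Hellinger bound for the mixture\<close>

lemma sqrt_diff_one_power2_le:
  assumes "-1 \<le> t" "1 \<le> p" "p \<le> 2"
  shows "(sqrt (1 + t) - 1)\<^sup>2 \<le> \<bar>t\<bar> powr p"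
proof -
  define w where "w = sqrt (1 + t)"
  have w: "0 \<le> w" and t: "t = w\<^sup>2 - 1" using assms by (auto simp: w_def)
  \<comment> \<open>With \<open>t = (w - 1) * (w + 1)\<close> the left side is at most
    \<open>t^2\<close> always, and at most \<open>t\<close> for \<open>t > 1\<close>. The first
    bound serves small \<open>t\<close>, the second large \<open>t\<close>, and every exponent
    between 1 and 2 fits both.\<close>
  show ?thesis
  proof (cases "\<bar>t\<bar> \<le> 1")
    case True
    have "(w - 1)\<^sup>2 * 1 \<le> (w - 1)\<^sup>2 * (w + 1)\<^sup>2"
      using w by (intro mult_left_mono) (auto intro!: one_le_power)
    also have "\<dots> = t\<^sup>2" unfolding t by (simp add: power2_eq_square algebra_simps)
    also have "\<dots> = \<bar>t\<bar> powr 2" by (cases "t = 0") (auto simp: powr_numeral)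
    also have "\<dots> \<le> \<bar>t\<bar> powr p" using True assms by (intro powr_mono') auto
    finally show ?thesis by (simp add: w_def)
  next
    case False
    then have "1 < t" using assms by linarith
    then have "1 \<le> w" by (simp add: w_def)
    then have "(w - 1)\<^sup>2 \<le> \<bar>t\<bar> powr 1" unfolding t by (simp add: power2_eq_square algebra_simps)
    also have "\<dots> \<le> \<bar>t\<bar> powr p" using \<open>1 < t\<close> assms by (intro powr_mono) auto
    finally show ?thesis by (simp add: w_def)
  qed
qed

text \<open>The exponential is the \<open>p\<close>-th moment of the normal likelihood ratio.
  Leaving \<open>p\<close> free allows the balance between the power of \<open>e\<close> and the
  growth of this moment to be chosen later.\<close>

lemma hellinger_normal_mix_le:
  assumes "0 \<le> e" "e \<le> 1" "1 \<le> p" "p \<le> 2"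
  shows "(\<integral>y. (sqrt (mix_density e m y) - 1)\<^sup>2 \<partial>std_normal_distribution)
    \<le> e powr p * (exp (p * (p - 1) * (m\<^sup>2 / 2)) + 1)"
proof -
  interpret N: real_distribution std_normal_distribution by (rule real_dist_normal_dist)
  define g where "g y = exp (m * y - m\<^sup>2 / 2)" for y
  have gp: "g y powr p = exp (- (p * (m\<^sup>2 / 2))) * exp ((p * m) * y)" for y
    by (simp add: g_def powr_def exp_add[symmetric] algebra_simps)
  have int: "integrable std_normal_distribution (\<lambda>y. e powr p * (g y powr p + 1))"
    unfolding gp using integrable_exp_std_normal by simp
  have bound: "(sqrt (mix_density e m y) - 1)\<^sup>2 \<le> e powr p * (g y powr p + 1)" for y
  proof -
    have "e * (g y - 1) \<ge> e * (-1)"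
      using assms by (intro mult_left_mono) (auto simp: g_def)
    then have "-1 \<le> e * (g y - 1)" using assms by linarith
    then have "(sqrt (mix_density e m y) - 1)\<^sup>2 \<le> \<bar>e * (g y - 1)\<bar> powr p"
      using sqrt_diff_one_power2_le assms by (simp add: mix_density_def g_def)
    also have "\<dots> = e powr p * \<bar>g y - 1\<bar> powr p"
      using assms by (simp add: abs_mult powr_mult)
    \<comment> \<open>As \<open>g y\<close> is positive, subtracting 1 cannot make the absolute
      value exceed the larger of the two terms.\<close>
    also have "\<bar>g y - 1\<bar> powr p \<le> (max (g y) 1) powr p"
    proof (rule powr_mono2)
      have "0 < g y" by (simp add: g_def)
      then show "\<bar>g y - 1\<bar> \<le> max (g y) 1" by (auto simp: abs_if max_def)
    qed (use assms in auto)
    also have "\<dots> \<le> g y powr p + 1"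
      by (auto simp: max_def)
    finally show ?thesis by (simp add: mult_left_mono)
  qed
  have [measurable]: "(\<lambda>y. (sqrt (mix_density e m y) - 1)\<^sup>2) \<in> borel_measurable std_normal_distribution"
    by simp
  have "(\<integral>y. (sqrt (mix_density e m y) - 1)\<^sup>2 \<partial>std_normal_distribution) \<le>
      (\<integral>y. e powr p * (g y powr p + 1) \<partial>std_normal_distribution)"
  proof (rule integral_mono)
    show "integrable std_normal_distribution (\<lambda>y. (sqrt (mix_density e m y) - 1)\<^sup>2)"
    proof (rule Bochner_Integration.integrable_bound[OF int])
      show "AE y in std_normal_distribution.
        norm ((sqrt (mix_density e m y) - 1)\<^sup>2) \<le> norm (e powr p * (g y powr p + 1))"
        using order_trans[OF bound abs_ge_self] by (intro AE_I2) simp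
    qed measurable
  qed (use int bound in auto)
  also have "\<dots> = e powr p * (exp (- (p * (m\<^sup>2 / 2))) * exp ((p * m)\<^sup>2 / 2) + 1)"
    unfolding gp using integrable_exp_std_normal N.prob_space by (simp add: integral_exp_std_normal)
  also have "exp (- (p * (m\<^sup>2 / 2))) * exp ((p * m)\<^sup>2 / 2) = exp (p * (p - 1) * (m\<^sup>2 / 2))"
    unfolding exp_add[symmetric] by (simp add: power2_eq_square algebra_simps)
  finally show ?thesis .
qed

lemma measure_normal_mix_rejection_le:
  assumes "0 \<le> e" "e \<le> 1" "1 \<le> p" "p \<le> 2" "0 \<le> c"
  shows "measure (\<Pi>\<^sub>M i\<in>{..<n}. normal_mix e m) (rejection s n c) \<le>
    2 * real n * (e powr p * (exp (p * (p - 1) * (m\<^sup>2 / 2)) + 1)) +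
    2 * measure (\<Pi>\<^sub>M i\<in>{..<n}. std_normal_distribution) (rejection s n c)"
proof -
  interpret N: real_distribution std_normal_distribution by (rule real_dist_normal_dist)
  have "measure (\<Pi>\<^sub>M i\<in>{..<n}. normal_mix e m) (rejection s n c) \<le>
    2 * real n * (\<integral>y. (sqrt (mix_density e m y) - 1)\<^sup>2 \<partial>std_normal_distribution) +
    2 * measure (\<Pi>\<^sub>M i\<in>{..<n}. std_normal_distribution) (rejection s n c)"
    unfolding normal_mix_def
    using assms by (intro PiM_density_measure_le N.prob_space_axioms mix_density_nonneg
        integrable_mix_density integral_mix_density sets_rejection) auto
  also have "\<dots> \<le> 2 * real n * (e powr p * (exp (p * (p - 1) * (m\<^sup>2 / 2)) + 1)) +
    2 * measure (\<Pi>\<^sub>M i\<in>{..<n}. std_normal_distribution) (rejection s n c)"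
    using hellinger_normal_mix_le[OF assms(1-4)] by (intro add_right_mono mult_left_mono) auto
  finally show ?thesis .
qed

section \<open>Power from a single test point\<close>

lemma ecdf_compose_normal_tail:
  "ecdf n (compose {..<n} normal_tail Y) (normal_tail z) = (\<Sum>i<n. indicator {z..} (Y i)) / real n"
proof -
  have "{i. i < n \<and> compose {..<n} normal_tail Y i \<le> normal_tail z} = {i \<in> {..<n}. Y i \<in> {z..}}"
    by (auto simp: compose_def)
  then show ?thesis
    by (simp add: ecdf_def indicator_def sum.If_cases Int_def)
qed

text \<open>The number of observations beyond \<open>z\<close> is binomial with success probability
  \<open>v + d\<close>, where \<open>v\<close> is the null mass and \<open>d\<close> the excess. The
  test rejects if at least half of the excess shows up and not all observations lie beyond
  \<open>z\<close>; the two subtracted terms bound the failures.\<close>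

lemma measure_normal_mix_rejection_ge:
  fixes n :: nat and z m v d :: real
  assumes "-1 \<le> s" and e: "0 \<le> e" "e \<le> 1" and "0 < n" "0 \<le> q"
  defines "v \<equiv> normal_tail z"
  defines "d \<equiv> e * (normal_tail (z - m) - v)"
  assumes v: "v \<le> 1/2" and d: "0 < d" and q: "q < d\<^sup>2 / (8 * (v + d))"
  shows "1 - exp (- (n * (d\<^sup>2 / (8 * (v + d))))) - (v + d) ^ n \<le>
    measure (\<Pi>\<^sub>M i\<in>{..<n}. normal_mix e m) (rejection s n q)"
proof -
  let ?M = "normal_mix e m" and ?P = "\<Pi>\<^sub>M i\<in>{..<n}. normal_mix e m"
  interpret M: real_distribution ?M by (intro real_distribution_normal_mix e)
  interpret P: prob_space ?P by (intro prob_space_PiM M.prob_space_axioms)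
  have p: "measure ?M {z..} = v + d"
    using e by (simp add: measure_normal_mix_atLeast v_def d_def)
  have v0: "0 < v" by (simp add: v_def)
  define S where "S Y = (\<Sum>i<n. indicator {z..} (Y i) :: real)" for Y
  have [measurable]: "S \<in> borel_measurable ?P"
    unfolding S_def
    by (intro borel_measurable_sum measurable_compose[OF measurable_component_singleton]) auto
  \<comment> \<open>With deviation \<open>n * d / 2\<close> the Chernoff exponent is
    \<open>n * d^2 / (8 * (v + d))\<close>, that is, \<open>n\<close> times the lower bound for the
    divergence obtained below. One quantity thus controls both threshold and error.\<close>
  define E1 where "E1 = {Y\<in>space ?P. S Y \<le> n * (v + d) - n * d / 2}"
  define E2 where "E2 = {Y\<in>space ?P. \<forall>i<n. Y i \<in> {z..}}"
  have [measurable]: "E1 \<in> sets ?P" unfolding E1_def by measurable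
  have "E2 = Pi\<^sub>E {..<n} (\<lambda>_. {z..})"
    by (auto simp: E2_def space_PiM PiE_def Pi_def)
  then have [measurable]: "E2 \<in> sets ?P" by (auto intro!: sets_PiM_I_finite)
  have *: "(n * d / 2)\<^sup>2 / (2 * real n * w) = n * (d\<^sup>2 / (8 * w))" for w
    using \<open>0 < n\<close> by (cases "w = 0") (auto simp: field_simps power2_eq_square)
  have "measure ?P E1 \<le> exp (- ((n * d / 2)\<^sup>2 / (2 * real n * measure ?M {z..})))"
    unfolding E1_def S_def p[symmetric] using v0 d \<open>0 < n\<close>
    by (intro binomial_lower_tail M.prob_space_axioms) (auto simp: p)
  then have E1: "measure ?P E1 \<le> exp (- (n * (d\<^sup>2 / (8 * (v + d)))))"
    by (simp only: * p)
  have E2: "measure ?P E2 = (v + d) ^ n"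
    unfolding E2_def p[symmetric] by (intro binomial_all M.prob_space_axioms) auto
  have "space ?P - (E1 \<union> E2) \<subseteq> rejection s n q"
  proof
    fix Y assume Y: "Y \<in> space ?P - (E1 \<union> E2)"
    define X where "X = compose {..<n} normal_tail Y"
    define u where "u = S Y / n"
    have ecdf: "ecdf n X v = u"
      by (simp add: u_def X_def v_def S_def ecdf_compose_normal_tail)
    have u: "v + d / 2 < u"
      using Y \<open>0 < n\<close> by (auto simp: E1_def u_def field_simps)
    obtain j where j: "j < n" "Y j \<notin> {z..}" using Y by (auto simp: E2_def)
    have "S Y = (\<Sum>i\<in>{..<n} - {j}. indicator {z..} (Y i))"
      unfolding S_def using j by (subst sum.remove[of _ j]) auto
    also have "\<dots> \<le> (\<Sum>i\<in>{..<n} - {j}. 1)" by (intro sum_mono) (simp add: indicator_def)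
    also have "\<dots> < n" using j by simp
    finally have u1: "u < 1" using \<open>0 < n\<close> by (simp add: u_def)
    define u0 where "u0 = v + d / 2"
    \<comment> \<open>The bound increases with \<open>u\<close> beyond \<open>v\<close>: after
      clearing denominators the difference factors as
      \<open>(u - u0) * (u * u0 - v * v)\<close>.\<close>
    have "(u0 - v)\<^sup>2 / (2 * u0) \<le> (u - v)\<^sup>2 / (2 * u)"
    proof -
      have "v * v \<le> u * u0" using u v0 d by (intro mult_mono) (auto simp: u0_def)
      then have "0 \<le> (u - u0) * (u * u0 - v * v)"
        using u by (intro mult_nonneg_nonneg) (auto simp: u0_def)
      also have "\<dots> = (u - v)\<^sup>2 * u0 - (u0 - v)\<^sup>2 * u" by (simp add: power2_eq_square algebra_simps)
      finally have "(u0 - v)\<^sup>2 * u \<le> (u - v)\<^sup>2 * u0" by simp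
      moreover have "0 < u" "0 < u0" using u v0 d by (auto simp: u0_def)
      ultimately show ?thesis by (simp add: divide_simps)
    qed
    moreover have "d\<^sup>2 / (8 * (v + d)) \<le> (u0 - v)\<^sup>2 / (2 * u0)"
    proof -
      have "(u0 - v)\<^sup>2 / (2 * u0) = d\<^sup>2 / (8 * v + 4 * d)"
        using v0 d by (simp add: u0_def field_simps power2_eq_square)
      also have "\<dots> \<ge> d\<^sup>2 / (8 * (v + d))"
        using v0 d by (intro divide_left_mono) (auto intro!: mult_pos_pos)
      finally show ?thesis .
    qed
    moreover have "(u - v)\<^sup>2 / (2 * u) \<le> K s u v"
      using u u1 v0 d by (intro K_ge \<open>-1 \<le> s\<close>) auto
    ultimately have "q < K s u v" using q by linarith
    then have "ereal q < S_plus s n X"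
      using u u1 v0 d v by (intro S_plus_greaterI[of v]) (auto simp: ecdf)
    moreover have "Y \<in> space (\<Pi>\<^sub>M i\<in>{..<n}. borel)"
      using Y by (simp add: space_PiM)
    ultimately show "Y \<in> rejection s n q" by (simp add: rejection_def X_def)
  qed
  then have "measure ?P (space ?P - (E1 \<union> E2)) \<le> measure ?P (rejection s n q)"
    by (intro P.finite_measure_mono sets_rejection) (auto simp: \<open>0 \<le> q\<close>)
  moreover have "measure ?P (space ?P - (E1 \<union> E2)) = 1 - measure ?P (E1 \<union> E2)"
    by (intro P.prob_compl) measurable
  moreover have "measure ?P (E1 \<union> E2) \<le> measure ?P E1 + measure ?P E2"
    by (intro measure_Un_le) measurable
  ultimately show ?thesis using E1 E2 by linarith
qed

text \<open>The ratio tends to 1 and the iterated logarithm is eventually positive, so any factor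
  above 1 would do in place of 2. Nonnegativity is what the comparison of the one-sided and
  two-sided statistics requires.\<close>

lemma admissible_levels_quantile:
  assumes "admissible_levels s \<alpha> q"
  shows "\<forall>\<^sub>F n in sequentially. 0 \<le> q n \<and> real n * q n \<le> 2 * ln (ln (real n))"
proof -
  have eq: "(\<lambda>n. real n * q n) \<sim>[sequentially] (\<lambda>n. ln (ln (real n)))"
    using assms by (simp add: admissible_levels_def)
  have pos: "\<forall>\<^sub>F n in sequentially. 0 < ln (ln (real n))" by real_asymp
  have "((\<lambda>n. real n * q n / ln (ln (real n))) \<longlongrightarrow> 1) sequentially"
    using eq pos by (intro asymp_equivD_strong) (auto elim!: eventually_mono)
  then have "\<forall>\<^sub>F n in sequentially. 0 < real n * q n / ln (ln (real n))"
      "\<forall>\<^sub>F n in sequentially. real n * q n / ln (ln (real n)) < 2"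
    by (auto intro: order_tendstoD)
  then show ?thesis
    using pos by eventually_elim (auto simp: zero_less_divide_iff field_simps zero_less_mult_iff)
qed

text \<open>Minimising the exponent \<open>1 - \<beta> p + r p (p - 1)\<close> over moment orders \<open>p \<le> 2\<close>:
  \<open>p = 1 / sqrt r\<close> makes it negative iff \<open>(1 - sqrt r)\<^sup>2 > 1 - \<beta>\<close>, and \<open>p = 2\<close> iff \<open>r < \<beta> - 1/2\<close>.\<close>

lemma below_rho_star:
  assumes \<beta>: "1/2 < \<beta>" "\<beta> < 1" and r: "0 < r" "r < rho_star \<beta>"
  obtains p where "1 \<le> p" "p \<le> 2" "1 - \<beta> * p < 0" "1 - \<beta> * p + r * (p * (p - 1)) < 0"
proof (cases "r < \<beta> - 1/2")
  case True
  then show ?thesis using \<beta> by (intro that[of 2]) auto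
next
  case False
  then have "3/4 < \<beta>" using r by (auto simp: rho_star_def split: if_splits)
  define b where "b = sqrt r"
  define h where "h = sqrt (1 - \<beta>)"
  have b: "0 < b" "b\<^sup>2 = r" using r by (auto simp: b_def)
  have h: "0 < h" "h < 1" "h\<^sup>2 = 1 - \<beta>" using \<beta> by (auto simp: h_def)
  have "b\<^sup>2 < (1 - h)\<^sup>2" using r \<open>3/4 < \<beta>\<close> by (simp add: b rho_star_def h_def)
  then have bh: "b < 1 - h" by (rule power2_less_imp_less) (use h(2) in simp)
  \<comment> \<open>This makes \<open>p = 1 / b\<close> at most 2: here \<open>r\<close> is at least
    \<beta> - 1/2, which exceeds 1/4.\<close>
  have "(1/2)\<^sup>2 < b\<^sup>2" unfolding b using False \<open>3/4 < \<beta>\<close> by (simp add: power2_eq_square)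
  then have b2: "1/2 < b" by (rule power2_less_imp_less) (use b(1) in simp)
  \<comment> \<open>From \<open>b < 1 - h < 1 - h^2 = \<beta>\<close> the order
    \<open>p = 1 / b\<close> also satisfies the other condition,
    \<open>1 - \<beta> * p < 0\<close>.\<close>
  have "h * h < h * 1" using h(1,2) by (intro mult_strict_left_mono) auto
  then have "h\<^sup>2 < h" by (simp add: power2_eq_square)
  then have "b < \<beta>" using bh h by linarith
  have "h\<^sup>2 < (1 - b)\<^sup>2" using bh h by (intro power_strict_mono) auto
  then have "2 * b - \<beta> - b\<^sup>2 < 0" using h by (simp add: power2_eq_square algebra_simps)
  moreover have "1 - \<beta> * (1 / b) + r * (1 / b * (1 / b - 1)) = (2 * b - \<beta> - b\<^sup>2) / b"
    using b by (simp add: b(2)[symmetric] field_simps power2_eq_square)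
  ultimately have "1 - \<beta> * (1 / b) + r * (1 / b * (1 / b - 1)) < 0"
    using b by (simp add: divide_neg_pos)
  then show ?thesis
    using b b2 \<open>b < \<beta>\<close> \<beta> by (intro that[of "1 / b"]) (auto simp: field_simps)
qed

lemma exp_mu_power2:
  assumes "1 \<le> n" "0 \<le> r"
  shows "exp (k * ((mu r n)\<^sup>2 / 2)) = real n powr (r * k)"
  using assms by (simp add: mu_def powr_def)

text \<open>Multiplied by \<open>n\<close>, the Hellinger bound becomes a sum of two powers of
  \<open>n\<close>, one from the moment and one from the constant 1; both exponents are negative for
  the chosen \<open>p\<close>, and the null probability contributes at most twice the level.\<close>

lemma power_plus_tendsto_0:
  assumes \<beta>: "1/2 < \<beta>" "\<beta> < 1" and r: "0 < r" "r < rho_star \<beta>" and adm: "admissible_levels s \<alpha> q"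
  shows "(\<lambda>n. power_plus s \<beta> r n (q n)) \<longlonglongrightarrow> 0"
proof -
  obtain p where p: "1 \<le> p" "p \<le> 2" "1 - \<beta> * p < 0" "1 - \<beta> * p + r * (p * (p - 1)) < 0"
    using below_rho_star[OF \<beta> r] by blast
  define B where "B n = 2 * (real n powr (1 - \<beta> * p + r * (p * (p - 1))) + real n powr (1 - \<beta> * p)) + 2 * \<alpha> n" for n
  have \<alpha>: "\<alpha> \<longlonglongrightarrow> 0" and \<alpha>1: "\<alpha> n < 1" for n
    using adm by (auto simp: admissible_levels_def)
  have "B \<longlonglongrightarrow> 2 * (0 + 0) + 2 * 0"
    unfolding B_def using p
    by (intro tendsto_intros \<alpha> tendsto_neg_powr filterlim_real_sequentially) auto
  then have B: "B \<longlonglongrightarrow> 0" by simp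
  have "\<forall>\<^sub>F n in sequentially. is_quantile s n (\<alpha> n) (q n)"
    using adm by (simp add: admissible_levels_def)
  then have "\<forall>\<^sub>F n in sequentially. power_plus s \<beta> r n (q n) \<le> B n"
    using admissible_levels_quantile[OF adm] eventually_ge_at_top[of 1]
  proof eventually_elim
    case (elim n)
    let ?e = "eps \<beta> n" and ?m = "mu r n"
    have "power_plus s \<beta> r n (q n) \<le> 2 * real n * (?e powr p * (exp (p * (p - 1) * (?m\<^sup>2 / 2)) + 1)) +
      2 * measure (\<Pi>\<^sub>M i\<in>{..<n}. std_normal_distribution) (rejection s n (q n))"
      using elim \<beta> p measure_normal_mix_rejection_le[of ?e p "q n" n ?m s]
      by (simp add: power_plus_eq eps_nonneg eps_le_1)
    also have "\<dots> \<le> 2 * real n * (?e powr p * (exp (p * (p - 1) * (?m\<^sup>2 / 2)) + 1)) + 2 * \<alpha> n"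
      using measure_rejection_null_le[of s n "\<alpha> n" "q n"] elim \<alpha>1 by simp
    also have "n * (?e powr p * (exp (p * (p - 1) * (?m\<^sup>2 / 2)) + 1)) =
        real n powr (1 - \<beta> * p + r * (p * (p - 1))) + real n powr (1 - \<beta> * p)"
    proof -
      have "?e powr p = real n powr (- \<beta> * p)" by (simp add: eps_def powr_powr)
      moreover have "real n = real n powr 1" using elim by simp
      ultimately have "n * (?e powr p * (exp (p * (p - 1) * (?m\<^sup>2 / 2)) + 1)) =
        real n powr 1 * (real n powr (- \<beta> * p) * (real n powr (r * (p * (p - 1))) + 1))"
        using exp_mu_power2[of n r "p * (p - 1)"] elim r by simp
      also have "\<dots> = real n powr (1 + - \<beta> * p + r * (p * (p - 1))) + real n powr (1 + - \<beta> * p)"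
        by (simp only: powr_add distrib_left mult.assoc mult_1_right)
      finally show ?thesis by simp
    qed
    then have "2 * real n * (?e powr p * (exp (p * (p - 1) * (?m\<^sup>2 / 2)) + 1)) =
        2 * (real n powr (1 - \<beta> * p + r * (p * (p - 1))) + real n powr (1 - \<beta> * p))"
      by simp
    finally show ?case by (simp add: B_def)
  qed
  moreover have "\<forall>\<^sub>F n in sequentially. 0 \<le> power_plus s \<beta> r n (q n)"
    by (simp add: power_plus_def)
  ultimately show ?thesis
    by (rule tendsto_sandwich[OF _ _ tendsto_const B, rotated])
qed

section \<open>Above the boundary\<close>

text \<open>The test looks at the level \<open>a * sqrt (2 ln n)\<close> on the normal scale, where
  \<open>a = min (2 * sqrt r) 1\<close>; with \<open>c = a - sqrt r\<close> the conditions say that the signal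
  \<open>n powr (-\<beta> - c\<^sup>2)\<close> beats the noise level \<open>n powr (-(1 + a\<^sup>2) / 2)\<close> and \<open>1 / n\<close>.\<close>

lemma above_rho_star:
  assumes \<beta>: "1/2 < \<beta>" "\<beta> < 1" and r: "0 < r" "r < 1" "rho_star \<beta> < r"
  obtains c where "0 \<le> c" "c \<le> 1" "0 < 1 - 2 * \<beta> - 2 * c\<^sup>2 + (sqrt r + c)\<^sup>2" "0 < 1 - \<beta> - c\<^sup>2"
proof (cases "sqrt r \<le> 1/2")
  case True
  then have "(sqrt r)\<^sup>2 \<le> (1/2)\<^sup>2" using r by (intro power_mono) auto
  then have r4: "r \<le> 1/4" using r by (simp add: power2_eq_square)
  \<comment> \<open>For \<beta> > 3/4 the boundary lies above 1/4, hence above \<open>r\<close>, so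
    only the linear branch survives in this case.\<close>
  have rb: "\<beta> - 1/2 < r"
  proof (cases "\<beta> \<le> 3/4")
    case True
    then show ?thesis using r by (simp add: rho_star_def)
  next
    case False
    then have "sqrt (1 - \<beta>) < 1/2" using real_sqrt_less_mono[of "1 - \<beta>" "1/4"]
      by (simp add: real_sqrt_divide)
    then have "(1/2)\<^sup>2 < (1 - sqrt (1 - \<beta>))\<^sup>2" by (intro power_strict_mono) auto
    then show ?thesis using r4 r False by (simp add: rho_star_def power2_eq_square)
  qed
  have "(sqrt r + sqrt r)\<^sup>2 = 4 * r" using r by (simp add: power2_eq_square algebra_simps)
  \<comment> \<open>With \<open>c = sqrt r\<close> the two quantities are
    \<open>1 - 2 * \<beta> + 2 * r\<close> and \<open>1 - \<beta> - r\<close>; the latter is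
    positive by \<beta> < r + 1/2 and r \<le> 1/4.\<close>
  then show ?thesis
    using r r4 rb True by (intro that[of "sqrt r"]) auto
next
  case False
  define b where "b = sqrt r"
  have b: "1/2 < b" "b < 1" using False r by (auto simp: b_def)
  \<comment> \<open>With \<open>c = 1 - b\<close>, hence \<open>a = 1\<close>, the first condition
    is twice the second, so this inequality settles both.\<close>
  have "(1 - b)\<^sup>2 < 1 - \<beta>"
  proof (cases "\<beta> \<le> 3/4")
    case True
    have "(1 - b)\<^sup>2 < (1/2)\<^sup>2" using b by (intro power_strict_mono) auto
    with True show ?thesis by (simp add: power2_eq_square)
  next
    case False
    define h where "h = sqrt (1 - \<beta>)"
    have h: "0 \<le> h" "h \<le> 1" "h\<^sup>2 = 1 - \<beta>" using \<beta> by (auto simp: h_def)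
    have "(1 - h)\<^sup>2 < b\<^sup>2" using r False by (simp add: rho_star_def h_def b_def)
    then have "1 - h < b" by (rule power2_less_imp_less) (use b in simp)
    then have "(1 - b)\<^sup>2 < h\<^sup>2" using b h(1) by (intro power_strict_mono) auto
    then show ?thesis using h(3) by simp
  qed
  then show ?thesis
    using b r(1) by (intro that[of "1 - b"]) (auto simp: b_def)
qed

text \<open>The tail is \<open>n powr (- c^2)\<close> up to a factor
  \<open>exp (O (sqrt (ln n)))\<close>, which the extra power \<eta> absorbs.\<close>

lemma normal_tail_ge_powr:
  assumes "0 \<le> c" "c \<le> 1" "0 < \<eta>"
  shows "\<forall>\<^sub>F n in sequentially. real n powr (- c\<^sup>2 - \<eta>) \<le> normal_tail (c * sqrt (2 * ln (real n)))"
proof -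
  \<comment> \<open>The square root pays for the cross term of \<open>(c * l + 1)^2 / 2\<close>; the
    3 pays for its constant 1/2 and for the 2 that replaces the factor
    \<open>sqrt (2 * pi)\<close>.\<close>
  have "\<forall>\<^sub>F n in sequentially. sqrt (2 * ln (real n)) + 3 \<le> \<eta> * ln (real n)"
    using assms(3) by real_asymp
  then show ?thesis
    using eventually_ge_at_top[of 1]
  proof eventually_elim
    case (elim n)
    define L where "L = ln (real n)"
    define l where "l = sqrt (2 * L)"
    have L: "0 \<le> L" using elim by (simp add: L_def)
    have l: "0 \<le> l" "l\<^sup>2 = 2 * L" using L by (auto simp: l_def)
    have cl: "c * l \<le> l" using assms l by (intro mult_left_le_one_le) auto
    have "sqrt (2 * pi) \<le> exp 2"
    proof (rule real_le_lsqrt)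
      have "2 * pi \<le> (1 + 2)\<^sup>2" using pi_less_4 by simp
      also have "\<dots> \<le> (exp 2)\<^sup>2" using exp_ge_add_one_self[of "2 :: real"] by (intro power_mono) auto
      finally show "2 * pi \<le> (exp 2)\<^sup>2" .
    qed simp
    have "real n powr (- c\<^sup>2 - \<eta>) = exp ((- c\<^sup>2 - \<eta>) * L)"
      using elim by (simp add: powr_def L_def)
    also have "(- c\<^sup>2 - \<eta>) * L \<le> - (c * l + 1)\<^sup>2 / 2 - 2"
    proof -
      have "(c * l + 1)\<^sup>2 / 2 = c\<^sup>2 * L + c * l + 1 / 2"
        using l(2) by (simp add: power2_sum power_mult_distrib)
      moreover have "l + 3 \<le> \<eta> * L" using elim by (simp add: l_def L_def)
      moreover have "(- c\<^sup>2 - \<eta>) * L = - (c\<^sup>2 * L) - \<eta> * L" by (simp add: algebra_simps)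
      ultimately show ?thesis using cl by linarith
    qed
    also have "exp (- (c * l + 1)\<^sup>2 / 2 - 2) = exp (- (c * l + 1)\<^sup>2 / 2) / exp 2"
      by (rule exp_diff)
    also have "\<dots> \<le> std_normal_density (c * l + 1)"
      using \<open>sqrt (2 * pi) \<le> exp 2\<close> by (simp add: std_normal_density_def frac_le)
    also have "\<dots> \<le> normal_tail (c * l)"
      using assms l by (intro normal_tail_ge) auto
    finally show ?case by (simp add: l_def L_def)
  qed
qed

lemma normal_tail_le_powr:
  assumes "0 \<le> a" "1 \<le> n"
  shows "normal_tail (a * sqrt (2 * ln (real n))) \<le> real n powr (- a\<^sup>2)"
proof -
  have "normal_tail (a * sqrt (2 * ln (real n))) \<le> exp (- (a * sqrt (2 * ln (real n)))\<^sup>2 / 2)"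
    using assms by (intro normal_tail_le) auto
  also have "\<dots> = real n powr (- a\<^sup>2)"
    using assms by (simp add: powr_def power_mult_distrib)
  finally show ?thesis .
qed

text \<open>The signal-to-noise ratio decreases with the noise and increases with the signal, so an
  upper bound for the former and a lower bound for the latter suffice.\<close>

lemma square_div_mono:
  fixes v V D d :: real
  assumes "0 < v" "v \<le> V" "0 < D" "D \<le> d"
  shows "D\<^sup>2 / (V + D) \<le> d\<^sup>2 / (v + d)"
proof -
  have "D\<^sup>2 / (V + D) \<le> D\<^sup>2 / (v + D)"
    using assms by (intro divide_left_mono) (auto intro!: mult_pos_pos add_pos_pos)
  also have "\<dots> \<le> d\<^sup>2 / (v + d)"
  proof -
    have "D\<^sup>2 * v \<le> d\<^sup>2 * v" "D * d * D \<le> D * d * d"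
      using assms by (auto intro!: mult_right_mono mult_left_mono power_mono)
    then have "D\<^sup>2 * (v + d) \<le> d\<^sup>2 * (v + D)" by (simp add: power2_eq_square algebra_simps)
    then show ?thesis using assms by (simp add: divide_simps)
  qed
  finally show ?thesis .
qed

lemma power_plus_tendsto_1:
  assumes s: "-1 \<le> s" and \<beta>: "1/2 < \<beta>" "\<beta> < 1" and r: "0 < r" "r < 1" "rho_star \<beta> < r"
    and adm: "admissible_levels s \<alpha> q"
  shows "(\<lambda>n. power_plus s \<beta> r n (q n)) \<longlonglongrightarrow> 1"
proof -
  obtain c where c: "0 \<le> c" "c \<le> 1" and e1: "0 < 1 - 2 * \<beta> - 2 * c\<^sup>2 + (sqrt r + c)\<^sup>2"
    and e2: "0 < 1 - \<beta> - c\<^sup>2"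
    using above_rho_star[OF \<beta> r] by blast
  define a where "a = sqrt r + c"
  have ac: "c < a" "0 \<le> a" using r c by (auto simp: a_def)
  then have e3: "0 < a\<^sup>2 - c\<^sup>2" using c by (simp add: power_strict_mono)
  \<comment> \<open>The factor 4 is used up in the first margin: two units for the loss \<eta> in
    \<open>W\<close>, which enters squared, one for absorbing constants, and one for the growth to
    be proved.\<close>
  define \<eta> where "\<eta> = min (min (1 - 2 * \<beta> - 2 * c\<^sup>2 + a\<^sup>2) (1 - \<beta> - c\<^sup>2)) (a\<^sup>2 - c\<^sup>2) / 4"
  have \<eta>: "0 < \<eta>" "4 * \<eta> \<le> 1 - 2 * \<beta> - 2 * c\<^sup>2 + a\<^sup>2" "4 * \<eta> \<le> 1 - \<beta> - c\<^sup>2" "4 * \<eta> \<le> a\<^sup>2 - c\<^sup>2"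
    using e1 e2 e3 by (auto simp: \<eta>_def a_def)
  define z where "z n = a * sqrt (2 * ln (real n))" for n
  define v where "v n = normal_tail (z n)" for n
  define d where "d n = eps \<beta> n * (normal_tail (z n - mu r n) - v n)" for n
  \<comment> \<open>Explicit powers of \<open>n\<close>: \<open>V\<close> bounds the noise
    \<open>v\<close> from above, \<open>W\<close> the shifted tail and \<open>D\<close> the signal
    \<open>d\<close> from below. The factor 1/2 in \<open>D\<close> pays for subtracting
    \<open>v\<close>, as \<open>V\<close> is at most an eighth of \<open>W\<close>.\<close>
  define V where "V n = real n powr (- a\<^sup>2)" for n
  define W where "W n = real n powr (- c\<^sup>2 - \<eta>)" for n
  define D where "D n = real n powr (- \<beta>) * W n / 2" for n
  have ev8: "\<forall>\<^sub>F n in sequentially. 8 \<le> real n powr \<eta>"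
    using \<eta>(1) by real_asymp
  have zm: "z n - mu r n = c * sqrt (2 * ln (real n))" for n
  proof -
    have "mu r n = sqrt r * sqrt (2 * ln (real n))"
      by (simp add: mu_def real_sqrt_mult[symmetric] mult_ac)
    then show ?thesis by (simp add: z_def a_def algebra_simps)
  qed
  have main: "\<forall>\<^sub>F n in sequentially. 0 < d n \<and> real n powr \<eta> \<le> n * ((d n)\<^sup>2 / (v n + d n)) \<and>
      v n \<le> 1/2 \<and> v n + d n \<le> 1/2"
  proof -
    have "(\<lambda>n. real n powr (- a\<^sup>2) + real n powr (- \<beta>)) \<longlonglongrightarrow> 0 + 0"
      using ac c \<beta> by (intro tendsto_add tendsto_neg_powr filterlim_real_sequentially) auto
    then have "\<forall>\<^sub>F n in sequentially. real n powr (- a\<^sup>2) + real n powr (- \<beta>) < 1/2"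
      by (intro order_tendstoD) auto
    then show ?thesis
      using normal_tail_ge_powr[OF c \<eta>(1)] ev8 eventually_ge_at_top[of 1]
    proof eventually_elim
      case (elim n)
      have n: "1 \<le> real n" "0 < real n" "real n powr 1 = real n" using elim by auto
      have mono: "real n powr x \<le> real n powr y" if "x \<le> y" for x y
        using n that by (intro powr_mono) auto
      have v: "0 < v n" "v n \<le> V n"
        using normal_tail_le_powr[of a n] ac elim by (auto simp: v_def V_def z_def)
      have w: "W n \<le> normal_tail (z n - mu r n)" using elim by (simp add: W_def zm)
      have W0: "0 < W n" using n by (simp add: W_def)
      have D0: "0 < D n" using W0 n by (simp add: D_def)
      have "8 * V n \<le> real n powr \<eta> * V n"
        using elim by (intro mult_right_mono) (auto simp: V_def)
      also have "\<dots> \<le> W n"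
        unfolding V_def W_def powr_add[symmetric] using \<eta> by (intro mono) auto
      finally have VW: "8 * V n \<le> W n" .
      have "D n \<le> real n powr (- \<beta>) * (W n - V n)"
        using VW W0 unfolding D_def times_divide_eq_right[symmetric] by (intro mult_left_mono) auto
      also have "\<dots> \<le> d n"
        unfolding d_def eps_def using v w by (intro mult_left_mono) auto
      finally have Dd: "D n \<le> d n" .
      have D1: "4 * real n powr \<eta> \<le> n * D n"
      proof -
        have "8 * real n powr \<eta> \<le> real n powr \<eta> * real n powr \<eta>"
          using elim by (intro mult_right_mono) auto
        also have "\<dots> \<le> real n powr (1 + - \<beta> + (- c\<^sup>2 - \<eta>))"
          unfolding powr_add[symmetric] using \<eta> by (intro mono) auto
        also have "\<dots> = n * (real n powr (- \<beta>) * W n)"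
          by (simp only: powr_add n(3) W_def mult.assoc)
        finally show ?thesis by (simp add: D_def)
      qed
      have D2: "2 * real n powr \<eta> * V n \<le> n * (D n)\<^sup>2"
      proof -
        have "8 * (real n powr \<eta> * V n) \<le> real n powr \<eta> * (real n powr \<eta> * V n)"
          using elim by (intro mult_right_mono) (auto simp: V_def)
        also have "\<dots> \<le> real n powr (1 + (- \<beta> + - \<beta>) + ((- c\<^sup>2 - \<eta>) + (- c\<^sup>2 - \<eta>)))"
          unfolding V_def powr_add[symmetric] using \<eta> by (intro mono) auto
        also have "\<dots> = n * ((real n powr (- \<beta>))\<^sup>2 * (W n)\<^sup>2)"
          by (simp only: powr_add n(3) W_def power2_eq_square mult.assoc)
        also have "\<dots> = 4 * (n * (D n)\<^sup>2)"
          by (simp add: D_def power_mult_distrib power_divide)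
        finally show ?thesis by (simp add: mult_ac)
      qed
      \<comment> \<open>Each summand takes half of the right side: \<open>D2\<close> handles
        \<open>V\<close> and \<open>D1\<close> handles \<open>D\<close>.\<close>
      have "real n powr \<eta> * (V n + D n) \<le> n * (D n)\<^sup>2"
      proof -
        have "2 * real n powr \<eta> * D n \<le> n * D n * D n"
        proof (rule mult_right_mono)
          have "0 \<le> real n powr \<eta>" by simp
          then show "2 * real n powr \<eta> \<le> n * D n" using D1 by linarith
        qed (use D0 in simp)
        then show ?thesis using D2 by (simp add: power2_eq_square algebra_simps)
      qed
      then have "real n powr \<eta> \<le> n * ((D n)\<^sup>2 / (V n + D n))"
        using v D0 by (simp add: field_simps)
      also have "\<dots> \<le> n * ((d n)\<^sup>2 / (v n + d n))"
        using v D0 Dd by (intro mult_left_mono square_div_mono) auto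
      finally have 1: "real n powr \<eta> \<le> n * ((d n)\<^sup>2 / (v n + d n))" .
      \<comment> \<open>Smallness of \<open>v n + d n\<close> keeps the test point within the range
        of the statistic and makes the probability that all observations lie beyond it at most
        \<open>(1/2) ^ n\<close>.\<close>
      have "d n \<le> real n powr (- \<beta>) * 1"
        unfolding d_def eps_def
      proof (rule mult_left_mono)
        show "normal_tail (z n - mu r n) - v n \<le> 1"
          using v(1) normal_tail_less_1[of "z n - mu r n"] by linarith
      qed simp
      then have "v n + d n \<le> 1/2" using v elim by (simp add: V_def)
      then show ?case using 1 D0 Dd by auto
    qed
  qed
  define B where "B n = 1 - exp (- (real n powr \<eta> / 8)) - (1/2) ^ n" for n :: nat
  have "(\<lambda>n. exp (- (real n powr \<eta> / 8))) \<longlonglongrightarrow> 0"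
    using \<eta>(1) by real_asymp
  then have "B \<longlonglongrightarrow> 1 - 0 - 0"
    unfolding B_def by (intro tendsto_intros LIMSEQ_power_zero) auto
  then have B: "B \<longlonglongrightarrow> 1" by simp
  have q: "\<forall>\<^sub>F n in sequentially. 2 * ln (ln (real n)) < real n powr \<eta> / 8"
    using \<eta>(1) by real_asymp
  have ge: "\<forall>\<^sub>F n in sequentially. B n \<le> power_plus s \<beta> r n (q n)"
    using main q admissible_levels_quantile[OF adm] eventually_ge_at_top[of 1]
  proof eventually_elim
    case (elim n)
    let ?T = "(d n)\<^sup>2 / (8 * (v n + d n))"
    have "real n powr \<eta> / 8 \<le> n * ((d n)\<^sup>2 / (v n + d n)) / 8"
      using elim by (intro divide_right_mono) auto
    also have "\<dots> = n * ?T"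
      by (simp only: divide_divide_eq_left times_divide_eq_right mult.commute[of 8])
    finally have T: "real n powr \<eta> / 8 \<le> n * ?T" .
    have "n * q n \<le> 2 * ln (ln (real n))" using elim by blast
    then have "n * q n < n * ?T" using elim(2) T by (meson le_less_trans less_le_trans)
    then have "q n < ?T" by (rule mult_left_less_imp_less) simp
    then have "1 - exp (- (n * ?T)) - (v n + d n) ^ n \<le>
        measure (\<Pi>\<^sub>M i\<in>{..<n}. normal_mix (eps \<beta> n) (mu r n)) (rejection s n (q n))"
      using elim s \<beta> unfolding d_def v_def
      by (intro measure_normal_mix_rejection_ge eps_nonneg eps_le_1) linarith+
    then have "1 - exp (- (n * ?T)) - (v n + d n) ^ n \<le> power_plus s \<beta> r n (q n)"
      using elim \<beta> by (subst power_plus_eq) auto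
    moreover have "B n \<le> 1 - exp (- (n * ?T)) - (v n + d n) ^ n"
      unfolding B_def
    proof (intro diff_mono order_refl)
      show "exp (- (n * ?T)) \<le> exp (- (real n powr \<eta> / 8))"
        using T by (simp only: exp_le_cancel_iff neg_le_iff_le)
      show "(v n + d n) ^ n \<le> (1/2) ^ n"
        using elim by (intro power_mono) (auto simp: v_def less_imp_le)
    qed
    ultimately show ?case by (rule order_trans[rotated])
  qed
  have le: "power_plus s \<beta> r n (q n) \<le> 1" if "0 \<le> q n" for n
  proof -
    have "prob_space (\<Pi>\<^sub>M i\<in>{..<n}. normal_mix (eps \<beta> n) (mu r n))"
      using \<beta> by (intro prob_space_PiM real_distribution.axioms(1) real_distribution_normal_mix eps_nonneg eps_le_1) auto
    then show ?thesis
      using that \<beta> by (simp add: power_plus_eq prob_space.prob_le_1)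
  qed
  show ?thesis
    using admissible_levels_quantile[OF adm]
    by (intro tendsto_sandwich[OF ge _ B tendsto_const]) (auto elim!: eventually_mono intro: le)
qed

text \<open>Strict bounds leave values of \<open>r\<close> in the open unit interval on both sides
  of the boundary, so the defining property determines it uniquely.\<close>

lemma rho_star_bounds:
  assumes "1/2 < \<beta>" "\<beta> < 1"
  shows "0 < rho_star \<beta>" "rho_star \<beta> < 1"
proof -
  define h where "h = sqrt (1 - \<beta>)"
  have h: "0 < h" "h < 1" using assms by (auto simp: h_def)
  then have "(1 - h)\<^sup>2 < 1\<^sup>2" by (intro power_strict_mono) auto
  moreover have "0 < (1 - h)\<^sup>2" using h by simp
  ultimately show "0 < rho_star \<beta>" "rho_star \<beta> < 1"
    using assms by (auto simp: rho_star_def h_def)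
qed

theorem theorem5p1:
  fixes s \<beta> :: real and \<alpha> q :: "nat \<Rightarrow> real"
  assumes "-1 \<le> s" and "s \<le> 2"
    and "1/2 < \<beta>" and "\<beta> < 1"
    and "admissible_levels s \<alpha> q"
  shows "\<forall>\<rho>. is_detection_boundary s q \<beta> \<rho> \<longleftrightarrow> \<rho> = rho_star \<beta>"
proof -
  have below: "(\<lambda>n. power_plus s \<beta> r n (q n)) \<longlonglongrightarrow> 0" if "0 < r" "r < rho_star \<beta>" for r
    using power_plus_tendsto_0 assms(3-5) that by blast
  have above: "(\<lambda>n. power_plus s \<beta> r n (q n)) \<longlonglongrightarrow> 1" if "0 < r" "r < 1" "rho_star \<beta> < r" for r
    using power_plus_tendsto_1 assms(1,3-5) that by blast
  have "\<rho> = rho_star \<beta>" if \<rho>: "is_detection_boundary s q \<beta> \<rho>" for \<rho>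
  proof (rule ccontr)
    assume "\<rho> \<noteq> rho_star \<beta>"
    \<comment> \<open>Clipping at 0 and 1 ensures that an \<open>r\<close> strictly between the two
      candidates is one to which the defining property applies; the power would then tend to both 0
      and 1.\<close>
    then consider "max \<rho> 0 < rho_star \<beta>" | "rho_star \<beta> < min \<rho> 1"
      using rho_star_bounds[OF assms(3,4)] by linarith
    then show False
    proof cases
      case 1
      then obtain r where r: "max \<rho> 0 < r" "r < rho_star \<beta>" using dense by blast
      then have "(\<lambda>n. power_plus s \<beta> r n (q n)) \<longlonglongrightarrow> 1"
        using \<rho> rho_star_bounds[OF assms(3,4)] by (auto simp: is_detection_boundary_def)
      with below[of r] r show False using LIMSEQ_unique[of _ 0 1] by fastforce
    next
      case 2
      then obtain r where r: "rho_star \<beta> < r" "r < min \<rho> 1" using dense by blast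
      then have "(\<lambda>n. power_plus s \<beta> r n (q n)) \<longlonglongrightarrow> 0"
        using \<rho> rho_star_bounds[OF assms(3,4)] by (auto simp: is_detection_boundary_def)
      with above[of r] r rho_star_bounds[OF assms(3,4)] show False
        using LIMSEQ_unique[of _ 0 1] by fastforce
    qed
  qed
  then show ?thesis
    using below above by (auto simp: is_detection_boundary_def)
qed

end
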